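(* Let $\mu\in M_{\mathrm{loc}}(\mathbf{R}^d\setminus\{0\})$ be rapidly decaying at infinity, and assume $\mu(H_{\omega,p})=0$ for almost all halfspaces $H_{\omega,p}$ with $\overline{H_{\omega,p}}\subset\mathbf{R}^d\setminus\{0\}$. Then $\mu=0$.
   Context: $H_{\omega,p}=\{x\in\mathbf{R}^d:x\cdot\omega<p\}$ (closure avoids $0$ iff $p<0$); "almost all" is with respect to surface measure on $S^{d-1}$ times Lebesgue measure. $M_{\mathrm{loc}}(\Omega)$ denotes signed Radon measures on $\Omega$. For $r>1$ let $\chi_r$ be a continuous function with $0\le\chi_r\le1$, $\chi_r(x)=0$ for $|x|<r-1$, $\chi_r(x)=1$ for $|x|>r$. A measure $\mu$ is rapidly decaying at infinity if the total variation $\|\chi_r\mu\|=\int\chi_r\,d|\mu|$ is finite and $O(r^{-m})$ as $r\to\infty$ for every $m>0$. *)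

theory Defs
  imports "HOL-Analysis.Analysis"
begin

definition halfspace :: "'a::euclidean_space \<Rightarrow> real \<Rightarrow> 'a set" where
  "halfspace \<omega> p = {x. x \<bullet> \<omega> < p}"

text \<open>A signed Radon measure on R^d minus the origin, given by its Jordan decomposition
  mu = M1 - M2: two mutually singular Borel measures, carried by R^d minus {0},
  finite on compact subsets of R^d minus {0}.\<close>
definition signed_radon_punctured :: "'a::euclidean_space measure \<Rightarrow> 'a measure \<Rightarrow> bool" where
  "signed_radon_punctured M1 M2 \<longleftrightarrow>
     sets M1 = sets borel \<and> sets M2 = sets borel \<and>
     emeasure M1 {0} = 0 \<and> emeasure M2 {0} = 0 \<and>
     (\<forall>K. compact K \<and> 0 \<notin> K \<longrightarrow> emeasure M1 K < \<infinity> \<and> emeasure M2 K < \<infinity>) \<and>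
     (\<exists>P\<in>sets borel. emeasure M1 P = 0 \<and> emeasure M2 (- P) = 0)"

definition cutoff_family :: "(real \<Rightarrow> 'a::euclidean_space \<Rightarrow> real) \<Rightarrow> bool" where
  "cutoff_family chi \<longleftrightarrow> (\<forall>r>1. continuous_on UNIV (chi r) \<and>
     (\<forall>x. 0 \<le> chi r x \<and> chi r x \<le> 1) \<and>
     (\<forall>x. norm x < r - 1 \<longrightarrow> chi r x = 0) \<and>
     (\<forall>x. norm x > r \<longrightarrow> chi r x = 1))"

text \<open>Total variation of chi_r mu, where |mu| = M1 + M2 (Jordan decomposition).\<close>
definition cut_tv :: "(real \<Rightarrow> 'a::euclidean_space \<Rightarrow> real) \<Rightarrow> 'a measure \<Rightarrow> 'a measure \<Rightarrow> real \<Rightarrow> ennreal" where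
  "cut_tv chi M1 M2 r = (\<integral>\<^sup>+ x. ennreal (chi r x) \<partial>M1) + (\<integral>\<^sup>+ x. ennreal (chi r x) \<partial>M2)"

definition rapidly_decaying :: "(real \<Rightarrow> 'a::euclidean_space \<Rightarrow> real) \<Rightarrow> 'a measure \<Rightarrow> 'a measure \<Rightarrow> bool" where
  "rapidly_decaying chi M1 M2 \<longleftrightarrow>
     (\<forall>r>1. cut_tv chi M1 M2 r < \<infinity>) \<and>
     (\<forall>m>0. \<exists>C R. \<forall>r\<ge>R. cut_tv chi M1 M2 r \<le> ennreal (C * r powr (- m)))"

end

theory Submission
  imports Defs
begin

text \<open>
  Write \<open>\<mu> = M1 - M2\<close>. The hypothesis says that \<open>\<integral> \<phi>(x \<bullet> w) d\<mu> = 0\<close> for every \<open>w\<close> and every continuous \<open>\<phi>\<close>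
  of polynomial growth that vanishes on some \<open>(-\<infinity>, b]\<close> with \<open>b > 0\<close>. Differentiating in \<open>w\<close> gives
  \<open>\<integral> P(x) \<phi>(x \<bullet> w) d\<mu> = 0\<close> for all polynomials \<open>P\<close>; this step uses the rapid decay. Averaging over the circle of
  directions \<open>w = cos t u + sin t v\<close> for a suitable \<open>\<phi>\<close> turns the ridge function into the truncated parabola
  \<open>(q(x) - c)\<^sub>+\<close> with \<open>q(x) = (x \<bullet> u)\<^sup>2 + (x \<bullet> v)\<^sup>2\<close>, and second differences in \<open>c\<close> give compactly supported
  functions of \<open>q\<close>. By the Weierstrass theorem the image of \<open>\<mu>\<close> under \<open>x \<mapsto> (x \<bullet> u, x \<bullet> v)\<close> therefore vanishes
  away from the origin. In particular \<open>\<integral> cos (x \<bullet> v) d\<mu>\<close> and \<open>\<integral> sin (x \<bullet> v) d\<mu>\<close> over \<open>{x. a < x \<bullet> u}\<close> are zero for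
  all \<open>v\<close> when \<open>a > 0\<close>, so that \<open>\<mu>\<close> vanishes on all these halfspaces, which cover the complement of the origin.
\<close>

section \<open>Uniqueness of finite measures\<close>

lemma measure_eqI_closed:
  fixes M N :: "'a::topological_space measure"
  assumes "finite_measure M" and [simp]: "sets M = sets borel" "sets N = sets borel"
    and eq: "\<And>C. closed C \<Longrightarrow> emeasure M C = emeasure N C"
  shows "M = N"
proof (rule measure_eqI_generator_eq[where E = "Collect closed" and \<Omega> = UNIV and A = "\<lambda>_. UNIV"])
  interpret M: finite_measure M by fact
  show "Int_stable (Collect closed)" by (auto simp: Int_stable_def)
  show "sets M = sigma_sets UNIV (Collect closed)" "sets N = sigma_sets UNIV (Collect closed)"
    unfolding assms borel_eq_closed by auto
  show "emeasure M UNIV \<noteq> \<infinity>" for i :: nat by simp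
qed (use eq in auto)

text \<open>The indicator of a closed set is a pointwise limit of bounded continuous functions of
  the distance to it, so dominated convergence reduces the claim to closed sets.\<close>

lemma measure_eqI_continuous:
  fixes M N :: "'a::euclidean_space measure"
  assumes "finite_measure M" "finite_measure N"
    and sets: "sets M = sets borel" "sets N = sets borel"
    and eq: "\<And>f::'a \<Rightarrow> real. continuous_on UNIV f \<Longrightarrow> (\<And>x. \<bar>f x\<bar> \<le> 1) \<Longrightarrow> (\<integral>x. f x \<partial>M) = (\<integral>x. f x \<partial>N)"
  shows "M = N"
proof (rule measure_eqI_closed)
  interpret M: finite_measure M by fact
  interpret N: finite_measure N by fact
  note [simp, measurable_cong] = sets
  fix C :: "'a set" assume C: "closed C"
  show "emeasure M C = emeasure N C"
  \<comment> \<open>The empty set is split off because \<open>infdist x {}\<close> is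
    \<open>0\<close> by convention, which would make \<open>f n\<close> constantly
    \<open>1\<close>.\<close>
  proof (cases "C = {}")
    case False
    define f where "f n x = max 0 (1 - real n * infdist x C)" for n x
    have cont: "continuous_on UNIV (f n)" for n
      unfolding f_def by (intro continuous_intros)
    have bound: "\<bar>f n x\<bar> \<le> 1" for n x
      by (auto simp: f_def infdist_nonneg)
    have lim: "(\<lambda>n. f n x) \<longlonglongrightarrow> indicator C x" for x
    proof (cases "x \<in> C")
      case True
      then show ?thesis by (auto simp: f_def)
    next
      case x: False
      then have d: "infdist x C > 0"
        using in_closed_iff_infdist_zero[OF C False] infdist_nonneg[of x C] by force
      obtain k where k: "1 < real k * infdist x C"
        using ex_less_of_nat_mult[OF d] by blast
      have "f n x = 0" if "n \<ge> k" for n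
      proof -
        have "real k * infdist x C \<le> real n * infdist x C"
          using that d by (intro mult_right_mono) auto
        with k show ?thesis by (auto simp: f_def)
      qed
      then have "eventually (\<lambda>n. f n x = 0) sequentially"
        by (auto simp: eventually_sequentially)
      then show ?thesis using x by (simp add: tendsto_eventually)
    qed
    have *: "(\<lambda>n. \<integral>x. f n x \<partial>M') \<longlonglongrightarrow> measure M' C"
      if "finite_measure M'" and [simp, measurable_cong]: "sets M' = sets borel" for M'
    proof -
      interpret M': finite_measure M' by fact
      have [measurable]: "C \<in> sets borel" using C by auto
      have "(\<lambda>n. \<integral>x. f n x \<partial>M') \<longlonglongrightarrow> (\<integral>x. indicator C x \<partial>M')"
      proof (rule integral_dominated_convergence)
        show "(indicator C :: 'a \<Rightarrow> real) \<in> borel_measurable M'" by measurable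
        show "f n \<in> borel_measurable M'" for n
          using borel_measurable_continuous_onI[OF cont[of n]] by simp
        show "integrable M' (\<lambda>_. 1::real)" by simp
      qed (use lim bound in auto)
      moreover have "(\<integral>x. indicator C x \<partial>M') = measure M' C"
        using C by (simp add: sets_eq_imp_space_eq[OF that(2)])
      ultimately show ?thesis by simp
    qed
    have "measure M C = measure N C"
      using *[OF assms(1) sets(1)] *[OF assms(2) sets(2)]
      by (simp add: eq[OF cont bound] LIMSEQ_unique)
    then show ?thesis by (simp add: M.emeasure_eq_measure N.emeasure_eq_measure)
  qed simp
qed fact+

text \<open>By Stone-Weierstrass, polynomials approximate a continuous function uniformly on
  \<open>K\<close>; the error outside \<open>K\<close> is invisible to both measures.\<close>

lemma measure_eqI_moments:
  fixes M N :: "'a::euclidean_space measure"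
  assumes "finite_measure M" "finite_measure N"
    and sets: "sets M = sets borel" "sets N = sets borel"
    and K: "compact K" "emeasure M (- K) = 0" "emeasure N (- K) = 0"
    and eq: "\<And>p. real_polynomial_function p \<Longrightarrow> (\<integral>x. p x \<partial>M) = (\<integral>x. p x \<partial>N)"
  shows "M = N"
proof (rule measure_eqI_continuous)
  interpret M: finite_measure M by fact
  interpret N: finite_measure N by fact
  fix f :: "'a \<Rightarrow> real" assume f: "continuous_on UNIV f" "\<And>x. \<bar>f x\<bar> \<le> 1"
  have AE: "AE x in M'. x \<in> K" if "sets M' = sets borel" "emeasure M' (- K) = 0" for M'
    by (rule AE_I[where N = "- K"]) (use that borel_compact[OF K(1)] in auto)
  define c where "c = measure M UNIV + measure N UNIV"
  have approx: "\<bar>(\<integral>x. f x \<partial>M') - (\<integral>x. p x \<partial>M')\<bar> \<le> e * measure M' UNIV"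
    if M': "finite_measure M'" "sets M' = sets borel" "emeasure M' (- K) = 0"
      and p: "real_polynomial_function p" "\<And>x. x \<in> K \<Longrightarrow> \<bar>f x - p x\<bar> < e" for M' p e
  proof -
    interpret M': finite_measure M' by fact
    have [measurable_cong, simp]: "sets M' = sets borel" by fact
    have sp: "space M' = UNIV" using sets_eq_imp_space_eq[OF M'(2)] by simp
    have pc: "continuous_on UNIV p"
      using p(1) by (simp add: continuous_on_polymonial_function real_polynomial_function_eq)
    have [measurable]: "p \<in> borel_measurable borel" "f \<in> borel_measurable borel"
      using f(1) pc by (auto intro: borel_measurable_continuous_onI)
    have intf: "integrable M' f"
      by (rule M'.integrable_const_bound[of _ 1]) (use f in auto)
    have intp: "integrable M' p"
    proof (rule M'.integrable_const_bound[of _ "1 + e"])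
      show "AE x in M'. norm (p x) \<le> 1 + e"
        using AE[OF M'(2,3)]
      proof eventually_elim
        case (elim x)
        then show ?case using p(2)[of x] f(2)[of x] by (simp add: abs_le_iff abs_less_iff)
      qed
    qed measurable
    have "\<bar>(\<integral>x. f x \<partial>M') - (\<integral>x. p x \<partial>M')\<bar> = \<bar>\<integral>x. f x - p x \<partial>M'\<bar>"
      using intf intp by simp
    also have "\<dots> \<le> (\<integral>x. \<bar>f x - p x\<bar> \<partial>M')" by (rule integral_abs_bound)
    also have "\<dots> \<le> (\<integral>x. e \<partial>M')"
      using intf intp AE[OF M'(2,3)] by (intro integral_mono_AE) (auto elim!: eventually_mono dest: p(2))
    finally show ?thesis by (simp add: sp mult.commute)
  qed
  have "\<bar>(\<integral>x. f x \<partial>M) - (\<integral>x. f x \<partial>N)\<bar> \<le> 0"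
  proof (rule field_le_epsilon)
    fix d :: real assume "d > 0"
    have c: "c \<ge> 0" by (simp add: c_def)
    \<comment> \<open>The summand \<open>1\<close> keeps the quotient defined when both measures are
      zero.\<close>
    define e where "e = d / (c + 1)"
    have e: "e > 0" "e * c \<le> d"
      using \<open>d > 0\<close> c by (auto simp: e_def field_simps)
    obtain p where p: "real_polynomial_function p" "\<And>x. x \<in> K \<Longrightarrow> \<bar>f x - p x\<bar> < e"
      using Stone_Weierstrass_real_polynomial_function[OF K(1) continuous_on_subset[OF f(1)] e(1)] by blast
    show "\<bar>(\<integral>x. f x \<partial>M) - (\<integral>x. f x \<partial>N)\<bar> \<le> 0 + d"
      using approx[OF assms(1) sets(1) K(2) p] approx[OF assms(2) sets(2) K(3) p] eq[OF p(1)] e(2)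
      by (simp add: c_def distrib_left)
  qed
  then show "(\<integral>x. f x \<partial>M) = (\<integral>x. f x \<partial>N)" by simp
qed fact+

section \<open>Trigonometric integrals and maps into a torus\<close>

lemma cos_sin_eq_imp_eq:
  fixes s t :: real
  assumes "cos s = cos t" "sin s = sin t" "\<bar>s - t\<bar> < 2 * pi"
  shows "s = t"
proof -
  have "cos (s - t) = 1"
    using assms(1,2) by (simp add: cos_diff flip: power2_eq_square)
  then obtain n :: int where n: "s - t = of_int n * (2 * pi)"
    by (auto simp: cos_one_2pi_int mult.assoc)
  have "\<bar>of_int n\<bar> * (2 * pi) < 1 * (2 * pi)"
    using assms(3) by (simp add: n abs_mult)
  then have "\<bar>real_of_int n\<bar> < 1"
    by (subst (asm) mult_less_cancel_right_pos) auto
  then have "n = 0" by linarith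
  with n show ?thesis by simp
qed

text \<open>Each coordinate is wrapped around a circle at angle \<open>x \<bullet> b / l\<close>.
  Storing cosines and sines as a pair of vectors places the torus in a Euclidean space, where a
  polynomial in the coordinates is a trigonometric polynomial in \<open>x\<close>. Large
  \<open>l\<close> wraps slowly, so the map is injective on large balls.\<close>

definition torus_map :: "real \<Rightarrow> 'a::euclidean_space \<Rightarrow> 'a \<times> 'a" where
  "torus_map l x = (\<Sum>b\<in>Basis. cos (x \<bullet> (b /\<^sub>R l)) *\<^sub>R b, \<Sum>b\<in>Basis. sin (x \<bullet> (b /\<^sub>R l)) *\<^sub>R b)"

lemma continuous_on_torus_map: "continuous_on A (torus_map l)"
  unfolding torus_map_def by (intro continuous_intros)

lemma torus_map_in_compact:
  "torus_map l (x::'a::euclidean_space) \<in> cball 0 (real DIM('a)) \<times> cball 0 (real DIM('a))"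
proof -
  have "norm (\<Sum>b\<in>Basis. g b *\<^sub>R (b::'a)) \<le> real DIM('a)" if "\<And>b. \<bar>g b\<bar> \<le> 1" for g :: "'a \<Rightarrow> real"
  proof -
    have "norm (\<Sum>b\<in>Basis. g b *\<^sub>R (b::'a)) \<le> (\<Sum>b\<in>(Basis::'a set). 1)"
      by (rule sum_norm_le) (simp add: that)
    then show ?thesis by simp
  qed
  then show ?thesis by (auto simp: torus_map_def)
qed

text \<open>Coordinates of \<open>x\<close> and \<open>y\<close> differ by less than
  \<open>l\<close>, hence the angles by less than a full turn.\<close>

lemma torus_map_eqD:
  fixes x y :: "'a::euclidean_space"
  assumes "l > 0" "torus_map l x = torus_map l y" "norm x + norm y < l"
  shows "x = y"
proof (rule euclidean_eqI)
  fix b :: 'a assume b: "b \<in> Basis"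
  have "cos (x \<bullet> (b /\<^sub>R l)) = cos (y \<bullet> (b /\<^sub>R l))"
    using arg_cong[OF assms(2), of "\<lambda>z. fst z \<bullet> b"] b by (simp add: torus_map_def)
  moreover have "sin (x \<bullet> (b /\<^sub>R l)) = sin (y \<bullet> (b /\<^sub>R l))"
    using arg_cong[OF assms(2), of "\<lambda>z. snd z \<bullet> b"] b by (simp add: torus_map_def)
  moreover have "\<bar>x \<bullet> (b /\<^sub>R l) - y \<bullet> (b /\<^sub>R l)\<bar> < 2 * pi"
  proof -
    have "\<bar>x \<bullet> b - y \<bullet> b\<bar> \<le> l * 1"
      using Basis_le_norm[OF b, of x] Basis_le_norm[OF b, of y] assms(3) by linarith
    then have "\<bar>x \<bullet> b - y \<bullet> b\<bar> / l \<le> 1"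
      using assms(1) by (simp add: field_simps)
    then have "\<bar>x \<bullet> (b /\<^sub>R l) - y \<bullet> (b /\<^sub>R l)\<bar> \<le> 1"
      using assms(1) by (simp add: field_simps abs_mult abs_divide flip: right_diff_distrib)
    then show ?thesis using pi_gt3 by linarith
  qed
  ultimately have "x \<bullet> (b /\<^sub>R l) = y \<bullet> (b /\<^sub>R l)"
    by (rule cos_sin_eq_imp_eq)
  then show "x \<bullet> b = y \<bullet> b" using assms(1) by simp
qed

text \<open>Trigonometric polynomials form an algebra, so the hypothesis gives equal moments for the
  images under the maps into a torus, which are injective on larger and larger balls.\<close>
lemma measure_eqI_cos_sin:
  fixes M N :: "'a::euclidean_space measure"
  assumes fin: "finite_measure M" "finite_measure N"
    and sets: "sets M = sets borel" "sets N = sets borel"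
    and cos_eq: "\<And>v. (\<integral>x. cos (x \<bullet> v) \<partial>M) = (\<integral>x. cos (x \<bullet> v) \<partial>N)"
    and sin_eq: "\<And>v. (\<integral>x. sin (x \<bullet> v) \<partial>M) = (\<integral>x. sin (x \<bullet> v) \<partial>N)"
  shows "M = N"
proof -
  interpret M: finite_measure M by fact
  interpret N: finite_measure N by fact
  note [simp, measurable_cong] = sets
  define bm where "bm f \<longleftrightarrow> f \<in> borel_measurable borel \<and> bounded (range f)" for f :: "'a \<Rightarrow> real"
  have bm_int: "integrable M f" "integrable N f" if "bm f" for f
  proof -
    have "\<exists>B. \<forall>x. norm (f x) \<le> B" using that by (simp add: bm_def bounded_iff)
    then obtain B where "\<And>x. norm (f x) \<le> B" by blast
    then show "integrable M f" "integrable N f"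
      using that by (auto simp: bm_def intro!: M.integrable_const_bound[of _ B] N.integrable_const_bound[of _ B])
  qed
  have bm_add: "bm (\<lambda>x. f x + g x)" if "bm f" "bm g" for f g
    using that by (auto simp: bm_def intro: bounded_plus_comp)
  have bm_mult: "bm (\<lambda>x. f x * g x)" if "bm f" "bm g" for f g
  proof -
    have "\<exists>A. \<forall>x. norm (f x) \<le> A" "\<exists>B. \<forall>x. norm (g x) \<le> B"
      using that by (simp_all add: bm_def bounded_iff)
    then obtain A B where AB: "\<And>x. norm (f x) \<le> A" "\<And>x. norm (g x) \<le> B" by blast
    have "norm (f x * g x) \<le> A * B" for x
      unfolding norm_mult using AB order_trans[OF norm_ge_zero AB(1)] by (intro mult_mono) auto
    then have "bounded (range (\<lambda>x. f x * g x))" by (auto simp: bounded_iff)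
    with that show ?thesis by (auto simp: bm_def)
  qed
  have bm_trig: "bm (\<lambda>x. cos (x \<bullet> v))" "bm (\<lambda>x. sin (x \<bullet> v))" for v
    by (auto simp: bm_def bounded_iff intro!: exI[of _ 1])
  have bm_const: "bm (\<lambda>x. c)" for c
    by (simp add: bm_def)
  \<comment> \<open>Asking for equality against every frequency \<open>v\<close>, not just for the
    plain integrals, makes the class stable under multiplication by cosines and sines: the product
    formulas only change \<open>v\<close> to \<open>w - v\<close> and \<open>w + v\<close>.\<close>
  define T where "T f \<longleftrightarrow> bm f \<and> (\<forall>v. (\<integral>x. f x * cos (x \<bullet> v) \<partial>M) = (\<integral>x. f x * cos (x \<bullet> v) \<partial>N)
     \<and> (\<integral>x. f x * sin (x \<bullet> v) \<partial>M) = (\<integral>x. f x * sin (x \<bullet> v) \<partial>N))" for f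
  have T_const: "T (\<lambda>x. c)" for c
    using bm_const by (simp add: T_def cos_eq sin_eq)
  have T_add: "T (\<lambda>x. f x + g x)" if "T f" "T g" for f g
  proof -
    have "bm f" "bm g" using that by (auto simp: T_def)
    note i = bm_int[OF bm_mult[OF \<open>bm f\<close> bm_trig(1)]] bm_int[OF bm_mult[OF \<open>bm f\<close> bm_trig(2)]]
        bm_int[OF bm_mult[OF \<open>bm g\<close> bm_trig(1)]] bm_int[OF bm_mult[OF \<open>bm g\<close> bm_trig(2)]]
    show ?thesis using that by (simp add: T_def bm_add distrib_right i)
  qed
  have T_scale: "T (\<lambda>x. c * f x)" if "T f" for c f
    using that bm_mult[OF bm_const[of c], of f] by (simp add: T_def mult.assoc)
  have T_cos: "T (\<lambda>x. f x * cos (x \<bullet> w))" if "T f" for f w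
  proof -
    have f: "bm f" using that by (auto simp: T_def)
    note i = bm_int[OF bm_mult[OF f bm_trig(1)]] bm_int[OF bm_mult[OF f bm_trig(2)]]
    have 1: "f x * cos (x \<bullet> w) * cos (x \<bullet> v) = (f x * cos (x \<bullet> (w - v)) + f x * cos (x \<bullet> (w + v))) / 2" for x v
      by (simp add: inner_diff_right inner_add_right cos_add cos_diff sin_add sin_diff algebra_simps)
    have 2: "f x * cos (x \<bullet> w) * sin (x \<bullet> v) = (f x * sin (x \<bullet> (w + v)) - f x * sin (x \<bullet> (w - v))) / 2" for x v
      by (simp add: inner_diff_right inner_add_right cos_add cos_diff sin_add sin_diff algebra_simps)
    show ?thesis using that bm_mult[OF f bm_trig(1)] unfolding T_def 1 2 by (simp add: i)
  qed
  have T_sin: "T (\<lambda>x. f x * sin (x \<bullet> w))" if "T f" for f w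
  proof -
    have f: "bm f" using that by (auto simp: T_def)
    note i = bm_int[OF bm_mult[OF f bm_trig(1)]] bm_int[OF bm_mult[OF f bm_trig(2)]]
    have 1: "f x * sin (x \<bullet> w) * cos (x \<bullet> v) = (f x * sin (x \<bullet> (w + v)) + f x * sin (x \<bullet> (w - v))) / 2" for x v
      by (simp add: inner_diff_right inner_add_right cos_add cos_diff sin_add sin_diff algebra_simps)
    have 2: "f x * sin (x \<bullet> w) * sin (x \<bullet> v) = (f x * cos (x \<bullet> (w - v)) - f x * cos (x \<bullet> (w + v))) / 2" for x v
      by (simp add: inner_diff_right inner_add_right cos_add cos_diff sin_add sin_diff algebra_simps)
    show ?thesis using that bm_mult[OF f bm_trig(2)] unfolding T_def 1 2 by (simp add: i)
  qed
  have T_sum: "T (\<lambda>x. \<Sum>i\<in>I. g i x)" if "finite I" "\<And>i. i \<in> I \<Longrightarrow> T (g i)" for I :: "'a set" and g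
    using that by (induction I rule: finite_induct) (auto intro: T_add T_const)
  \<comment> \<open>The factor \<open>f\<close> is generalized so that a product of polynomials is
    absorbed one factor at a time: first \<open>p\<close> into \<open>f\<close>, then
    \<open>q\<close> into the result.\<close>
  have poly: "T (\<lambda>x. f x * p (torus_map l x))" if "real_polynomial_function p" "T f" for p f l
    using that
  proof (induction p arbitrary: f rule: real_polynomial_function.induct)
    case (linear h)
    \<comment> \<open>The vector representing the linear functional \<open>h\<close>.\<close>
    define g where "g = adjoint h 1"
    have h: "h z = z \<bullet> g" for z
      using adjoint_works[OF bounded_linear.linear[OF linear(1)], of z 1] by (simp add: g_def)
    have "f x * h (torus_map l x) = (\<Sum>b\<in>Basis. (b \<bullet> fst g) * (f x * cos (x \<bullet> (b /\<^sub>R l))))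
        + (\<Sum>b\<in>Basis. (b \<bullet> snd g) * (f x * sin (x \<bullet> (b /\<^sub>R l))))" for x
      by (simp add: h inner_prod_def torus_map_def inner_sum_left distrib_left sum_distrib_left mult_ac)
    then show ?case
      by (simp only:) (intro T_add T_sum T_scale T_cos T_sin linear(2) finite_Basis)
  next
    case (const c)
    then show ?case using T_scale[of f c] by (simp add: mult.commute)
  next
    case (add p q)
    then show ?case using T_add[OF add.IH(1)[OF add.prems] add.IH(2)[OF add.prems]] by (simp add: distrib_left)
  next
    case (mult p q)
    then show ?case using mult.IH(2)[OF mult.IH(1)[OF mult.prems]] by (simp add: mult.assoc)
  qed
  have torus_measurable [measurable]: "torus_map l \<in> borel_measurable borel" for l :: real
    by (intro borel_measurable_continuous_onI continuous_on_torus_map)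
  have distr_eq: "distr M borel (torus_map l) = distr N borel (torus_map l)" for l
  proof (rule measure_eqI_moments)
    let ?K = "cball (0::'a) (real DIM('a)) \<times> cball (0::'a) (real DIM('a))"
    show "compact ?K" by (intro compact_Times compact_cball)
    then have [measurable]: "?K \<in> sets borel" by (rule borel_compact)
    have "torus_map l -` (- ?K) = {}" using torus_map_in_compact by blast
    then show "emeasure (distr M borel (torus_map l)) (- ?K) = 0" 
      "emeasure (distr N borel (torus_map l)) (- ?K) = 0"
      by (simp_all add: emeasure_distr)
    fix p :: "'a \<times> 'a \<Rightarrow> real" assume p: "real_polynomial_function p"
    then have [measurable]: "p \<in> borel_measurable borel"
      by (intro borel_measurable_continuous_onI) (simp add: continuous_on_polymonial_function real_polynomial_function_eq)
    have "T (\<lambda>x. 1 * p (torus_map l x))" by (rule poly[OF p T_const])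
    \<comment> \<open>Frequency \<open>v = 0\<close> in \<open>T\<close> recovers the plain
      integral, since the cosine is then \<open>1\<close>.\<close>
    then have "(\<integral>x. p (torus_map l x) * cos (x \<bullet> 0) \<partial>M) = (\<integral>x. p (torus_map l x) * cos (x \<bullet> 0) \<partial>N)"
      by (simp add: T_def del: inner_zero_right)
    then show "(\<integral>x. p x \<partial>distr M borel (torus_map l)) = (\<integral>x. p x \<partial>distr N borel (torus_map l))"
      by (simp add: integral_distr)
  qed (auto intro!: M.finite_measure_distr N.finite_measure_distr)
  show ?thesis
  proof (rule measure_eqI_closed[OF fin(1) sets])
    fix C :: "'a set" assume C: "closed C"
    define l where "l n = real n + 1" for n :: nat
    \<comment> \<open>\<open>A n\<close> is the part of \<open>C\<close> in a ball, enlarged to a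
      union of fibres of the torus map, so both measures agree on it. Two points of norm at most
      \<open>n / 2\<close> have norms adding up to less than \<open>l n = n + 1\<close>; by
      injectivity \<open>A n\<close> and \<open>C\<close> coincide in that ball, and
      \<open>A n\<close> tends to \<open>C\<close> pointwise.\<close>
    define I where "I n = torus_map (l n) ` (C \<inter> cball 0 (real n / 2))" for n
    define A where "A n = torus_map (l n) -` I n" for n
    have I [measurable]: "I n \<in> sets borel" for n
      unfolding I_def using C by (intro borel_compact compact_continuous_image continuous_on_torus_map)
        (simp add: closed_Int_compact)
    have A [measurable]: "A n \<in> sets borel" for n
      unfolding A_def using measurable_sets[OF torus_measurable I] by simp
    have ev: "eventually (\<lambda>n. (indicator (A n) x :: real) = indicator C x) sequentially" for x
    proof -
      obtain k :: nat where k: "2 * norm x \<le> real k" using real_arch_simple by blast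
      have "x \<in> A n \<longleftrightarrow> x \<in> C" if "n \<ge> k" for n
      proof
        have nx: "norm x \<le> real n / 2" using that k by linarith
        show "x \<in> A n" if "x \<in> C" using that nx by (auto simp: A_def I_def)
        assume "x \<in> A n"
        then obtain y where y: "y \<in> C" "norm y \<le> real n / 2" "torus_map (l n) x = torus_map (l n) y"
          by (auto simp: A_def I_def)
        then have "x = y" using nx by (intro torus_map_eqD[OF _ y(3)]) (auto simp: l_def)
        then show "x \<in> C" using y by simp
      qed
      then show ?thesis by (auto simp: eventually_sequentially indicator_def)
    qed
    have lim: "(\<lambda>n. measure M' (A n)) \<longlonglongrightarrow> measure M' C"
      if "finite_measure M'" and [simp, measurable_cong]: "sets M' = sets borel" for M' :: "'a measure"
    proof -
      interpret M': finite_measure M' by fact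
      have [measurable]: "C \<in> sets borel" using C by auto
      have sp: "space M' = UNIV" using sets_eq_imp_space_eq[OF that(2)] by simp
      have "(\<lambda>n. \<integral>x. indicator (A n) x \<partial>M') \<longlonglongrightarrow> (\<integral>x. indicator C x \<partial>M' :: real)"
      proof (rule integral_dominated_convergence)
        show "integrable M' (\<lambda>_. 1::real)" by simp
        show "AE x in M'. (\<lambda>n. indicator (A n) x :: real) \<longlonglongrightarrow> indicator C x"
          using ev by (auto intro: tendsto_eventually)
      qed (auto simp: indicator_def)
      then show ?thesis by (simp add: sp)
    qed
    have "measure M (A n) = measure N (A n)" for n
    proof -
      have "emeasure (distr M borel (torus_map (l n))) (I n) = emeasure (distr N borel (torus_map (l n))) (I n)"
        by (simp add: distr_eq)
      then show ?thesis
        using sets_eq_imp_space_eq[OF sets(1)] sets_eq_imp_space_eq[OF sets(2)]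
        by (simp add: emeasure_distr A_def measure_def)
    qed
    then have "measure M C = measure N C"
      using lim[OF fin(1) sets(1)] lim[OF fin(2) sets(2)] by (simp add: LIMSEQ_unique)
    then show "emeasure M C = emeasure N C"
      by (simp add: M.emeasure_eq_measure N.emeasure_eq_measure)
  qed
qed

section \<open>Averages of ridge functions over a circle\<close>

text \<open>For \<open>s\<close> within one period the piece leaving the interval at one end
  re-enters at the other. Any other \<open>s\<close> is reduced to this case by whole
  periods.\<close>

lemma integral_shift_periodic:
  fixes g :: "real \<Rightarrow> real"
  assumes cont: "continuous_on UNIV g" and per: "\<And>t. g (t + 2 * pi) = g t"
  shows "integral {- pi..pi} (\<lambda>t. g (t - s)) = integral {- pi..pi} g"
proof -
  have int: "g integrable_on {a..b}" for a b
    by (rule integrable_continuous_real) (rule continuous_on_subset[OF cont], simp)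
  define H where "H s = integral {- pi - s..pi - s} g" for s
  have shift: "integral {- pi..pi} (\<lambda>t. g (t - s)) = H s" for s
    using integral_shift_Icc_real[of "-pi" pi g "-s"] by (simp add: H_def o_def)
  have loop: "integral {-pi - s..-pi} g = integral {pi - s..pi} g" for s
    using integral_shift_Icc_real[of "-pi - s" "-pi" g "2 * pi"] per by (simp add: o_def add.commute)
  have H: "H s = integral {-pi..pi} g" if "0 \<le> s" "s \<le> 2 * pi" for s
  proof -
    have "H s = integral {-pi - s..-pi} g + integral {-pi..pi - s} g"
      unfolding H_def by (rule Henstock_Kurzweil_Integration.integral_combine[symmetric]) (use that int in auto)
    also have "\<dots> = integral {-pi..pi - s} g + integral {pi - s..pi} g"
      by (simp add: loop)
    also have "\<dots> = integral {-pi..pi} g"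
      by (rule Henstock_Kurzweil_Integration.integral_combine) (use that int in auto)
    finally show ?thesis .
  qed
  have periodic: "H (s + 2 * pi) = H s" for s
    using integral_shift_Icc_real[of "- pi - (s + 2 * pi)" "pi - (s + 2 * pi)" g "2 * pi"] per
    by (simp add: H_def o_def add.commute algebra_simps)
  have periodic_nat: "H (s + real n * (2 * pi)) = H s" for s n
  proof (induction n)
    case (Suc n)
    then show ?case using periodic[of "s + real n * (2 * pi)"] by (simp add: algebra_simps)
  qed simp
  \<comment> \<open>Iteration of the period is available for natural multiples only, so the sign of
    \<open>k\<close> decides whether periods are added to \<open>s'\<close> or to
    \<open>s\<close>.\<close>
  define k where "k = \<lfloor>s / (2 * pi)\<rfloor>"
  define s' where "s' = s - of_int k * (2 * pi)"
  have "of_int k \<le> s / (2 * pi)" "s / (2 * pi) \<le> of_int k + 1"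
    unfolding k_def by linarith+
  then have s': "0 \<le> s'" "s' \<le> 2 * pi"
    by (auto simp: s'_def field_simps)
  have "H s = H s'"
  proof (cases "k \<ge> 0")
    case True
    then show ?thesis using periodic_nat[of s' "nat k"] by (simp add: s'_def)
  next
    case False
    then show ?thesis using periodic_nat[of s "nat (- k)"] by (simp add: s'_def)
  qed
  with H[OF s'] shift show ?thesis by simp
qed

text \<open>The value is \<open>pi / 2\<close>. It will occur as a common factor of two integrals,
  so that being nonzero is enough to cancel it.\<close>

definition semicircle_area :: real where
  "semicircle_area = integral {-1..1} (\<lambda>y. sqrt (1 - y\<^sup>2))"

lemma semicircle_area_pos: "semicircle_area > 0"
proof -
  have cont: "continuous_on {-1..1} (\<lambda>y::real. sqrt (1 - y\<^sup>2))"
    by (intro continuous_intros)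
  have nonneg: "sqrt (1 - y\<^sup>2) \<ge> 0" if "y \<in> {-1..1}" for y :: real
    using that by (simp add: abs_square_le_1 abs_le_iff)
  have "semicircle_area \<noteq> 0"
  proof
    assume "semicircle_area = 0"
    then have "\<forall>y\<in>{-1..1::real}. sqrt (1 - y\<^sup>2) = 0"
      using integral_eq_0_iff[OF cont _ nonneg] by (simp add: semicircle_area_def)
    from bspec[OF this, of 0] show False by simp
  qed
  moreover have "semicircle_area \<ge> 0"
    unfolding semicircle_area_def using nonneg by (intro integral_nonneg integrable_continuous_real cont) auto
  ultimately show ?thesis by simp
qed

text \<open>For \<open>q > 0\<close> this is the area under a semicircle of radius
  \<open>R = sqrt q\<close>, obtained from the unit one by scaling. The interval up to
  \<open>r\<close> contains the whole support, because \<open>R \<le> r\<close>.\<close>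

lemma integral_semicircle:
  fixes r q :: real
  assumes "r \<ge> 0" "q \<le> r\<^sup>2"
  shows "integral {-r..r} (\<lambda>z. sqrt (max 0 (q - z\<^sup>2))) = semicircle_area * max 0 q"
proof (cases "q > 0")
  case False
  then have "max 0 (q - z\<^sup>2) = 0" for z
    using zero_le_power2[of z] by linarith
  then show ?thesis using False by simp
next
  case True
  define R where "R = sqrt q"
  have R: "R > 0" "R\<^sup>2 = q" using True by (auto simp: R_def)
  have "R \<le> r" using assms by (metis R_def real_le_rsqrt real_sqrt_le_mono real_sqrt_abs abs_of_nonneg)
  let ?h = "\<lambda>z. sqrt (max 0 (q - z\<^sup>2))"
  have "((\<lambda>y. sqrt (1 - y\<^sup>2)) has_integral semicircle_area) (cbox (-1) 1)"
    unfolding semicircle_area_def box_real by (intro integrable_integral integrable_continuous_real continuous_intros)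
  from has_integral_affinity'[OF this, of "1 / R" 0] R(1)
  have "((\<lambda>z. sqrt (1 - (z / R)\<^sup>2)) has_integral R * semicircle_area) {-R..R}"
    by simp
  from has_integral_mult_right[OF this, of R]
  have "((\<lambda>z. R * sqrt (1 - (z / R)\<^sup>2)) has_integral q * semicircle_area) {-R..R}"
    by (simp add: R(2)[symmetric] power2_eq_square mult.assoc)
  moreover have "R * sqrt (1 - (z / R)\<^sup>2) = ?h z" if "z \<in> {-R..R}" for z
  proof -
    have "z\<^sup>2 \<le> R\<^sup>2" using that R(1) by (intro abs_le_square_iff[THEN iffD1]) auto
    then have "?h z = sqrt (R\<^sup>2 * (1 - (z / R)\<^sup>2))"
      using R(1) by (simp add: R(2)[symmetric] field_simps)
    also have "\<dots> = R * sqrt (1 - (z / R)\<^sup>2)" using R(1) by (simp add: real_sqrt_mult)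
    finally show ?thesis by simp
  qed
  ultimately have "(?h has_integral q * semicircle_area) {-R..R}"
    by (rule has_integral_eq[rotated])
  then have "(?h has_integral q * semicircle_area) {-r..r}"
  proof (rule has_integral_on_superset)
    show "?h z = 0" if "z \<notin> {-R..R}" for z
    proof -
      have "R\<^sup>2 \<le> z\<^sup>2" using that R(1) by (intro abs_le_square_iff[THEN iffD1]) auto
      then show ?thesis using R(2) by simp
    qed
  qed (use \<open>R \<le> r\<close> in auto)
  then show ?thesis using True by (simp add: integral_unique mult.commute)
qed

text \<open>Chosen so that the substitution \<open>z = r sin t\<close> reduces the average of \<open>ridge c\<close> over a circle
  to the area of a semicircle.\<close>
definition ridge :: "real \<Rightarrow> real \<Rightarrow> real" where
  "ridge c t = max 0 t * sqrt (max 0 (t\<^sup>2 - c))"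

lemma continuous_on_ridge: "continuous_on A (ridge c)"
  unfolding ridge_def by (intro continuous_intros)

text \<open>With \<open>z = r * sin t\<close> one has
  \<open>(r * cos t)\<^sup>2 - c = (r\<^sup>2 - c) - z\<^sup>2\<close>, and the factor
  \<open>max 0 t\<close> of \<open>ridge\<close> supplies the derivative \<open>r * cos t\<close>.
  On the half of the circle where the cosine is nonpositive the integrand vanishes.\<close>

lemma integral_ridge_cos:
  assumes "r \<ge> 0" "c \<ge> 0"
  shows "integral {-pi..pi} (\<lambda>t. ridge c (r * cos t)) = semicircle_area * max 0 (r\<^sup>2 - c)"
proof -
  let ?h = "\<lambda>z. sqrt (max 0 ((r\<^sup>2 - c) - z\<^sup>2))"
  have "((\<lambda>t. (r * cos t) *\<^sub>R ?h (r * sin t)) has_integral integral {r * sin (-(pi/2))..r * sin (pi/2)} ?h) {-(pi/2)..pi/2}"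
  proof (rule has_integral_substitution[where c = "-r" and d = r])
    show "(\<lambda>t. r * sin t) ` {- (pi / 2)..pi / 2} \<subseteq> {- r..r}"
      using assms mult_left_mono[OF sin_le_one, of r] mult_left_mono[OF sin_ge_minus_one, of r] by auto
    show "continuous_on {-r..r} ?h" by (intro continuous_intros)
    show "((\<lambda>t. r * sin t) has_field_derivative r * cos t) (at t within {-(pi/2)..pi/2})" for t
      by (auto intro!: derivative_eq_intros)
  qed (use assms in auto)
  also have "integral {r * sin (-(pi/2))..r * sin (pi/2)} ?h = semicircle_area * max 0 (r\<^sup>2 - c)"
    using integral_semicircle[of r "r\<^sup>2 - c"] assms by simp
  finally have mid: "((\<lambda>t. (r * cos t) *\<^sub>R ?h (r * sin t)) has_integral semicircle_area * max 0 (r\<^sup>2 - c)) {-(pi/2)..pi/2}" .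
  have "(r * cos t) *\<^sub>R ?h (r * sin t) = ridge c (r * cos t)" if "t \<in> {-(pi/2)..pi/2}" for t
  proof -
    have "0 \<le> r * cos t" using assms(1) that cos_ge_zero[of t] by auto
    moreover have "(r * cos t)\<^sup>2 - c = r\<^sup>2 - c - (r * sin t)\<^sup>2"
      by (simp add: power_mult_distrib cos_squared_eq algebra_simps)
    ultimately show ?thesis unfolding ridge_def by (simp only: max_absorb2 real_scaleR_def)
  qed
  from has_integral_eq[OF this mid]
  have "((\<lambda>t. ridge c (r * cos t)) has_integral semicircle_area * max 0 (r\<^sup>2 - c)) {-(pi/2)..pi/2}" .
  moreover have zero: "ridge c (r * cos t) = 0" if "pi / 2 \<le> t" "t \<le> pi" for t
  proof -
    have "cos t \<le> 0" using cos_ge_zero[of "pi - t"] that by simp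
    then show ?thesis using assms(1) by (simp add: ridge_def mult_nonneg_nonpos max_absorb1)
  qed
  have "((\<lambda>t. ridge c (r * cos t)) has_integral 0) {pi/2..pi}"
    by (rule has_integral_is_0) (use zero in auto)
  moreover have "((\<lambda>t. ridge c (r * cos t)) has_integral 0) {-pi..-(pi/2)}"
  proof (rule has_integral_is_0)
    show "ridge c (r * cos t) = 0" if "t \<in> {-pi..-(pi/2)}" for t
      using zero[of "- t"] that by auto
  qed
  moreover have "- (pi / 2) \<le> pi" using pi_gt_zero by linarith
  ultimately have "((\<lambda>t. ridge c (r * cos t)) has_integral (0 + (semicircle_area * max 0 (r\<^sup>2 - c) + 0))) {-pi..pi}"
    by (intro has_integral_combine[of "-pi" "-(pi/2)" pi] has_integral_combine[of "-(pi/2)" "pi/2" pi]) auto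
  then have "((\<lambda>t. ridge c (r * cos t)) has_integral semicircle_area * max 0 (r\<^sup>2 - c)) {-pi..pi}"
    by simp
  then show ?thesis by (rule integral_unique)
qed

text \<open>In polar coordinates the argument becomes \<open>r * cos (t - s)\<close>, and the shift
  by \<open>s\<close> does not affect an integral over a full period.\<close>

lemma integral_ridge_circle:
  assumes "c \<ge> 0"
  shows "integral {-pi..pi} (\<lambda>t. ridge c (a * cos t + b * sin t)) = semicircle_area * max 0 (a\<^sup>2 + b\<^sup>2 - c)"
proof -
  obtain r s where "r \<ge> 0" and s: "a = r * cos s" "b = r * sin s"
  proof -
    \<comment> \<open>The radius obtained here may be negative; its sign is then moved into the
      angle as a shift by \<open>pi\<close>.\<close>
    obtain r s where *: "a = r * cos s" "b = r * sin s"
      using polar_Ex[of a b] by blast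
    then have "a = - r * cos (s + pi)" "b = - r * sin (s + pi)" by simp_all
    with * that[of r s] that[of "- r" "s + pi"] show ?thesis by linarith
  qed
  have r: "r\<^sup>2 = a\<^sup>2 + b\<^sup>2"
    by (simp add: s power_mult_distrib flip: distrib_left)
  have "integral {-pi..pi} (\<lambda>t. ridge c (a * cos t + b * sin t)) = integral {-pi..pi} (\<lambda>t. ridge c (r * cos (t - s)))"
    by (simp add: s cos_diff algebra_simps)
  also have "\<dots> = integral {-pi..pi} (\<lambda>t. ridge c (r * cos t))"
    by (rule integral_shift_periodic[of "\<lambda>t. ridge c (r * cos t)"])
      (auto intro!: continuous_on_compose2[OF continuous_on_ridge[of UNIV]] continuous_intros)
  also have "\<dots> = semicircle_area * max 0 (a\<^sup>2 + b\<^sup>2 - c)"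
    using integral_ridge_cos[OF \<open>r \<ge> 0\<close> assms] by (simp add: r)
  finally show ?thesis .
qed

section \<open>Functions of polynomial growth\<close>

text \<open>The base \<open>1 + norm x\<close> is at least \<open>1\<close>, so bounds with
  different exponents can be compared.\<close>

definition poly_growth :: "('a::real_normed_vector \<Rightarrow> real) \<Rightarrow> bool" where
  "poly_growth f \<longleftrightarrow> (\<exists>C m. 0 \<le> C \<and> (\<forall>x. \<bar>f x\<bar> \<le> C * (1 + norm x) ^ m))"

lemma poly_growth_mult:
  assumes "poly_growth f" "poly_growth g"
  shows "poly_growth (\<lambda>x. f x * g x)"
proof -
  obtain C D m n where "0 \<le> C" "0 \<le> D" and C: "\<And>x. \<bar>f x\<bar> \<le> C * (1 + norm x) ^ m" and D: "\<And>x. \<bar>g x\<bar> \<le> D * (1 + norm x) ^ n"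
    using assms unfolding poly_growth_def by blast
  then have "\<bar>f x * g x\<bar> \<le> (C * D) * (1 + norm x) ^ (m + n)" for x
    using mult_mono[OF C[of x] D[of x]] by (simp add: abs_mult power_add mult_ac)
  then show ?thesis using \<open>0 \<le> C\<close> \<open>0 \<le> D\<close> unfolding poly_growth_def by (meson mult_nonneg_nonneg)
qed

lemma poly_growth_add:
  assumes "poly_growth f" "poly_growth g"
  shows "poly_growth (\<lambda>x. f x + g x)"
proof -
  obtain C D m n where CD: "0 \<le> C" "0 \<le> D" and C: "\<And>x. \<bar>f x\<bar> \<le> C * (1 + norm x) ^ m" and D: "\<And>x. \<bar>g x\<bar> \<le> D * (1 + norm x) ^ n"
    using assms unfolding poly_growth_def by blast
  have "\<bar>f x + g x\<bar> \<le> (C + D) * (1 + norm x) ^ (m + n)" for x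
  proof -
    have "C * (1 + norm x) ^ m \<le> C * (1 + norm x) ^ (m + n)" "D * (1 + norm x) ^ n \<le> D * (1 + norm x) ^ (m + n)"
      using CD by (auto intro!: mult_left_mono power_increasing)
    then show ?thesis using C[of x] D[of x] by (simp add: distrib_right abs_le_iff)
  qed
  then show ?thesis using CD unfolding poly_growth_def by (meson add_nonneg_nonneg)
qed

lemma poly_growth_mono:
  assumes "poly_growth g" "\<And>x. \<bar>f x\<bar> \<le> \<bar>g x\<bar>"
  shows "poly_growth f"
  using assms unfolding poly_growth_def by (meson order_trans)

lemma poly_growth_const: "poly_growth (\<lambda>x. c)"
  unfolding poly_growth_def by (rule exI[of _ "\<bar>c\<bar>"], rule exI[of _ 0]) simp

lemma poly_growth_bounded_linear:
  assumes "bounded_linear f"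
  shows "poly_growth f"
proof -
  obtain K where "0 \<le> K" and K: "\<And>x. norm (f x) \<le> norm x * K"
    using bounded_linear.nonneg_bounded[OF assms] by auto
  have "\<bar>f x\<bar> \<le> K * (1 + norm x) ^ 1" for x
    using K[of x] \<open>0 \<le> K\<close> by (simp add: distrib_left mult.commute)
  then show ?thesis using \<open>0 \<le> K\<close> unfolding poly_growth_def by blast
qed

lemma poly_growth_polynomial: "real_polynomial_function f \<Longrightarrow> poly_growth f"
  by (induction f rule: real_polynomial_function.induct)
    (auto intro: poly_growth_bounded_linear poly_growth_const poly_growth_add poly_growth_mult)

text \<open>The bound is uniform over all \<open>w\<close> in a ball. It provides the dominating
  functions whenever the direction varies: in limits, in difference quotients and in averages over a
  circle.\<close>

lemma poly_growth_inner:
  fixes \<phi> :: "real \<Rightarrow> real"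
  assumes "poly_growth \<phi>"
  obtains C m where "0 \<le> C"
    "\<And>x w :: 'a::real_inner. norm w \<le> A \<Longrightarrow> \<bar>\<phi> (x \<bullet> w)\<bar> \<le> C * (1 + norm x) ^ m"
proof -
  obtain C m where "0 \<le> C" and C: "\<And>x. \<bar>\<phi> x\<bar> \<le> C * (1 + \<bar>x\<bar>) ^ m"
    using assms unfolding poly_growth_def by auto
  have "\<bar>\<phi> (x \<bullet> w)\<bar> \<le> (C * (1 + \<bar>A\<bar>) ^ m) * (1 + norm x) ^ m" if "norm w \<le> A" for x w :: 'a
  proof -
    have "\<bar>x \<bullet> w\<bar> \<le> norm x * \<bar>A\<bar>"
      by (rule order_trans[OF Cauchy_Schwarz_ineq2]) (use that in \<open>auto intro!: mult_left_mono\<close>)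
    moreover have "(1 + \<bar>A\<bar>) * (1 + norm x) = 1 + norm x + \<bar>A\<bar> + norm x * \<bar>A\<bar>"
      by (simp add: algebra_simps)
    ultimately have "1 + \<bar>x \<bullet> w\<bar> \<le> (1 + \<bar>A\<bar>) * (1 + norm x)"
      using norm_ge_zero[of x] by linarith
    then have "C * (1 + \<bar>x \<bullet> w\<bar>) ^ m \<le> C * ((1 + \<bar>A\<bar>) * (1 + norm x)) ^ m"
      using \<open>0 \<le> C\<close> by (intro mult_left_mono power_mono) auto
    with C[of "x \<bullet> w"] show ?thesis by (simp add: power_mult_distrib mult.assoc)
  qed
  then show ?thesis using \<open>0 \<le> C\<close> by (intro that[of "C * (1 + \<bar>A\<bar>) ^ m" m]) auto
qed

text \<open>These are the profiles of the ridge functions. For \<open>b > 0\<close>, the function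
  \<open>\<phi> (x \<bullet> w)\<close> is supported where \<open>x \<bullet> w > b\<close> or in
  the closure of this set, which is away from the origin.\<close>

definition tame :: "real \<Rightarrow> (real \<Rightarrow> real) \<Rightarrow> bool" where
  "tame b \<phi> \<longleftrightarrow> continuous_on UNIV \<phi> \<and> (\<forall>t\<le>b. \<phi> t = 0) \<and> poly_growth \<phi>"

lemma tame_ridge:
  assumes "c \<ge> 0"
  shows "tame (sqrt c) (ridge c)"
proof -
  have "ridge c t = 0" if "t \<le> sqrt c" for t
  proof (cases "t \<ge> 0")
    case True
    then have "t\<^sup>2 \<le> c" using power_mono[OF that True, of 2] assms by simp
    then show ?thesis by (simp add: ridge_def)
  qed (simp add: ridge_def)
  moreover have "\<bar>ridge c t\<bar> \<le> \<bar>t * t\<bar>" for t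
  proof -
    have "sqrt (max 0 (t\<^sup>2 - c)) \<le> sqrt (t\<^sup>2)"
      using assms by (intro real_sqrt_le_mono) simp
    then show ?thesis unfolding ridge_def abs_mult by (intro mult_mono) auto
  qed
  then have "poly_growth (ridge c)"
    by (rule poly_growth_mono[rotated])
      (intro poly_growth_mult poly_growth_bounded_linear bounded_linear_ident)
  ultimately show ?thesis by (simp add: tame_def continuous_on_ridge)
qed

text \<open>Integrating from \<open>b\<close> preserves the vanishing up to \<open>b\<close> and
  raises the growth exponent by one.\<close>

lemma tame_antiderivative:
  assumes "tame b \<phi>" "b \<ge> 0"
  obtains \<Phi> where "tame b \<Phi>" "\<And>t. (\<Phi> has_real_derivative \<phi> t) (at t)"
proof -
  have cont: "continuous_on A \<phi>" for A
    using assms(1) continuous_on_subset by (auto simp: tame_def)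
  have int: "\<phi> integrable_on {s..t}" for s t
    by (rule integrable_continuous_real) (rule cont)
  obtain C m where "0 \<le> C" and C: "\<And>t. \<bar>\<phi> t\<bar> \<le> C * (1 + \<bar>t\<bar>) ^ m"
    using assms(1) unfolding tame_def poly_growth_def by auto
  define \<Phi> where "\<Phi> t = integral {b..t} \<phi>" for t
  \<comment> \<open>As \<open>\<phi>\<close> vanishes up to \<open>b\<close>, the base point can be
    moved to the left. For \<open>t < b\<close> the integral over the empty interval
    \<open>{b..t}\<close> is \<open>0\<close>, in agreement with this.\<close>
  have eq: "\<Phi> t = integral {a..t} \<phi>" if "a \<le> b" "a \<le> t" for a t
  proof (cases "b \<le> t")
    case True
    have "integral {a..b} \<phi> = 0"
      using assms(1) by (intro integral_unique has_integral_is_0) (auto simp: tame_def)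
    then show ?thesis
      using Henstock_Kurzweil_Integration.integral_combine[of a b t \<phi>] that True int by (simp add: \<Phi>_def)
  next
    case False
    have "integral {a..t} \<phi> = 0"
      using assms(1) False by (intro integral_unique has_integral_is_0) (auto simp: tame_def)
    then show ?thesis using False by (simp add: \<Phi>_def)
  qed
  have deriv: "(\<Phi> has_real_derivative \<phi> t) (at t)" for t
  proof -
    \<comment> \<open>A base point strictly left of both \<open>b\<close> and \<open>t\<close>, so
      that \<open>t\<close> is interior and a two-sided derivative results.\<close>
    define a where "a = min b t - 1"
    have "((\<lambda>u. integral {a..u} \<phi>) has_real_derivative \<phi> t) (at t within {a..t+1})"
      by (rule integral_has_real_derivative) (use cont in \<open>auto simp: a_def\<close>)
    then have "((\<lambda>u. integral {a..u} \<phi>) has_real_derivative \<phi> t) (at t within {a<..<t+1})"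
      by (rule DERIV_subset) auto
    then have "((\<lambda>u. integral {a..u} \<phi>) has_real_derivative \<phi> t) (at t)"
      by (subst (asm) at_within_open) (auto simp: a_def)
    then show ?thesis
    proof (rule has_field_derivative_transform_within_open[where S = "{a<..<t+1}"])
      show "t \<in> {a<..<t+1}" by (auto simp: a_def)
      show "integral {a..u} \<phi> = \<Phi> u" if "u \<in> {a<..<t+1}" for u
        using that by (intro eq[symmetric]) (auto simp: a_def)
    qed simp
  qed
  have "\<bar>\<Phi> t\<bar> \<le> C * (1 + \<bar>t\<bar>) ^ Suc m" for t
  proof (cases "b \<le> t")
    case True
    have "norm (integral {b..t} \<phi>) \<le> (C * (1 + \<bar>t\<bar>) ^ m) * (t - b)"
    proof (rule integral_bound[OF True cont])
      fix s assume "s \<in> {b..t}"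
      then have "C * (1 + \<bar>s\<bar>) ^ m \<le> C * (1 + \<bar>t\<bar>) ^ m"
        using \<open>0 \<le> C\<close> \<open>b \<ge> 0\<close> by (intro mult_left_mono power_mono) auto
      then show "norm (\<phi> s) \<le> C * (1 + \<bar>t\<bar>) ^ m" using C[of s] by simp
    qed
    also have "\<dots> \<le> (C * (1 + \<bar>t\<bar>) ^ m) * (1 + \<bar>t\<bar>)"
      using \<open>0 \<le> C\<close> \<open>b \<ge> 0\<close> by (intro mult_left_mono) auto
    finally show ?thesis by (simp add: \<Phi>_def mult_ac)
  next
    case False
    then show ?thesis using \<open>0 \<le> C\<close> by (simp add: \<Phi>_def)
  qed
  then have "poly_growth \<Phi>"
    using \<open>0 \<le> C\<close> unfolding poly_growth_def real_norm_def by blast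
  moreover have "continuous_on UNIV \<Phi>"
    using DERIV_isCont[OF deriv] by (simp add: continuous_at_imp_continuous_on)
  moreover have "\<Phi> t = 0" if "t \<le> b" for t
    using that by (cases "t = b") (auto simp: \<Phi>_def)
  ultimately show ?thesis using deriv by (intro that) (auto simp: tame_def)
qed

section \<open>Ridge functions and polynomial weights\<close>

text \<open>The exceptional set is Lebesgue null, whereas every ball has positive measure.\<close>

lemma AE_lborel_dense:
  fixes x :: "'a::euclidean_space"
  assumes "AE y in lborel. P y" "e > 0"
  obtains y where "P y" "dist x y < e"
proof -
  have "\<exists>y\<in>ball x e. P y"
  proof (rule ccontr)
    assume "\<not> ?thesis"
    with assms(1) have "AE y in lborel. y \<notin> ball x e" by (auto elim: eventually_mono)
    then have "ball x e \<in> null_sets lborel"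
      by (subst AE_iff_null_sets) auto
    then have "measure lborel (ball x e) = 0" by (simp add: measure_def null_sets_def)
    with content_ball_pos[OF \<open>e > 0\<close>, of x] show False by simp
  qed
  then show ?thesis using that by auto
qed

text \<open>By Cauchy-Schwarz the halfspace stays at distance \<open>- p / norm w\<close> from the
  origin. Written without a division, the condition also makes sense for
  \<open>w = 0\<close>.\<close>

lemma halfspace_subset_norm:
  assumes "p < 0" "\<epsilon> * norm w \<le> - p" "\<epsilon> \<ge> 0" "x \<in> halfspace w p"
  shows "\<epsilon> < norm x"
proof -
  have "- p < \<bar>x \<bullet> w\<bar>" using assms by (simp add: halfspace_def)
  also have "\<dots> \<le> norm x * norm w" by (rule Cauchy_Schwarz_ineq2)
  finally have *: "\<epsilon> * norm w < norm x * norm w" using assms by simp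
  then show ?thesis by (metis mult_right_mono norm_ge_zero not_le)
qed

lemma halfspace_measurable [measurable]: "halfspace w p \<in> sets borel"
  unfolding halfspace_def by measurable

text \<open>Describes a pair of measures after restriction to
  \<open>{x. \<epsilon> < norm x}\<close>: they become finite with all moments, and only the
  halfspaces that avoid the ball are still comparable, which is the condition
  \<open>\<epsilon> * norm w \<le> - p\<close>. Vectors \<open>w\<close> need not be
  normalized.\<close>

locale halfspace_pair =
  fixes M N :: "'a::euclidean_space measure" and \<epsilon> :: real
  assumes fin: "finite_measure M" "finite_measure N"
    and sets [simp, measurable_cong]: "sets M = sets borel" "sets N = sets borel"
    and moments: "integrable M (\<lambda>x. (1 + norm x) ^ m)" "integrable N (\<lambda>x. (1 + norm x) ^ m)"
    and eps: "\<epsilon> \<ge> 0"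
    and halfspaces: "AE w in lborel. \<forall>p<0. \<epsilon> * norm w \<le> - p \<longrightarrow> emeasure M (halfspace w p) = emeasure N (halfspace w p)"
begin

sublocale M: finite_measure M by (rule fin)
sublocale N: finite_measure N by (rule fin)

lemma space_eq [simp]: "space M = UNIV" "space N = UNIV"
  using sets_eq_imp_space_eq[OF sets(1)] sets_eq_imp_space_eq[OF sets(2)] by simp_all

lemma integrable_poly_growth:
  assumes [measurable]: "f \<in> borel_measurable borel" and "poly_growth f"
  shows "integrable M f" "integrable N f"
proof -
  obtain C m where "0 \<le> C" and C: "\<And>x. \<bar>f x\<bar> \<le> C * (1 + norm x) ^ m"
    using assms(2) unfolding poly_growth_def by auto
  then have le: "norm (f x) \<le> norm (C * (1 + norm x) ^ m)" for x
    by (simp add: abs_mult)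
  show "integrable M f"
    by (rule Bochner_Integration.integrable_bound[of _ "\<lambda>x. C * (1 + norm x) ^ m"]) (use le moments in auto)
  show "integrable N f"
    by (rule Bochner_Integration.integrable_bound[of _ "\<lambda>x. C * (1 + norm x) ^ m"]) (use le moments in auto)
qed

lemma integrable_mult_tame:
  assumes "real_polynomial_function f" "tame b \<phi>"
  shows "integrable M (\<lambda>x. f x * \<phi> (x \<bullet> w))" "integrable N (\<lambda>x. f x * \<phi> (x \<bullet> w))"
proof -
  have "continuous_on UNIV f" "continuous_on UNIV \<phi>"
    using assms by (simp_all add: continuous_on_polymonial_function real_polynomial_function_eq tame_def)
  then have [measurable]: "f \<in> borel_measurable borel" "\<phi> \<in> borel_measurable borel"
    by (auto intro: borel_measurable_continuous_onI)
  obtain C m where *: "0 \<le> C" "\<And>x. \<bar>\<phi> (x \<bullet> w)\<bar> \<le> C * (1 + norm x) ^ m"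
    using poly_growth_inner[of \<phi> "norm w"] assms(2) by (metis order_refl tame_def)
  then have "poly_growth (\<lambda>x. \<phi> (x \<bullet> w))" unfolding poly_growth_def by blast
  with poly_growth_polynomial[OF assms(1)] have "poly_growth (\<lambda>x. f x * \<phi> (x \<bullet> w))"
    by (rule poly_growth_mult)
  then show "integrable M (\<lambda>x. f x * \<phi> (x \<bullet> w))" "integrable N (\<lambda>x. f x * \<phi> (x \<bullet> w))"
    by (auto intro!: integrable_poly_growth)
qed

text \<open>For a fixed \<open>w\<close>, the halfspaces determine the image of the measure on the
  line under \<open>x \<bullet> w\<close>, far from \<open>0\<close>. The minus sign turns the
  halfspaces with negative offset into rays towards plus infinity.\<close>

lemma tame_integral_AE:
  assumes "tame b \<phi>" "b > 0"
  shows "AE w in lborel. \<epsilon> * norm w < b \<longrightarrow> (\<integral>x. \<phi> (- (x \<bullet> w)) \<partial>M) = (\<integral>x. \<phi> (- (x \<bullet> w)) \<partial>N)"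
  using halfspaces
proof eventually_elim
  case (elim w)
  show ?case
  proof
    assume w: "\<epsilon> * norm w < b"
    have [measurable]: "\<phi> \<in> borel_measurable borel"
      using assms by (intro borel_measurable_continuous_onI) (simp add: tame_def)
    \<comment> \<open>Cutting down to the halfspace at \<open>- b\<close> makes every ray
      \<open>{t<..}\<close>, also for small \<open>t\<close>, correspond to an admissible halfspace.
      Nothing is lost, since \<open>\<phi>\<close> vanishes up to \<open>b\<close>.\<close>
    define D where "D L = distr (density L (indicator (halfspace w (- b)))) borel (\<lambda>x. - (x \<bullet> w))" for L :: "'a measure"
    have em: "emeasure (D L) {t<..} = emeasure L (halfspace w (min (- b) (- t)))"
      if [simp, measurable_cong]: "sets L = sets borel" for L t
    proof -
      have sp: "space L = UNIV" using sets_eq_imp_space_eq[OF that] by simp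
      have "(\<lambda>x. - (x \<bullet> w)) -` {t<..} \<inter> halfspace w (- b) = halfspace w (min (- b) (- t))"
        by (auto simp: halfspace_def)
      moreover have "{x. t < - (x \<bullet> w)} \<in> sets borel" by measurable
      then have "(\<lambda>x. - (x \<bullet> w)) -` {t<..} \<in> sets borel" by (simp add: vimage_def)
      ultimately show ?thesis
        by (simp add: D_def emeasure_distr sp Int_commute emeasure_restricted[of "halfspace w (- b)"])
    qed
    have int: "(\<integral>t. \<phi> t \<partial>D L) = (\<integral>x. \<phi> (- (x \<bullet> w)) \<partial>L)" 
      if [simp, measurable_cong]: "sets L = sets borel" for L
    proof -
      have "(\<integral>t. \<phi> t \<partial>D L) = (\<integral>x. \<phi> (- (x \<bullet> w)) \<partial>density L (\<lambda>x. ennreal (indicator (halfspace w (- b)) x)))"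
        by (simp add: D_def integral_distr ennreal_indicator)
      also have "\<dots> = (\<integral>x. indicator (halfspace w (- b)) x *\<^sub>R \<phi> (- (x \<bullet> w)) \<partial>L)"
        by (rule integral_density) auto
      also have "\<dots> = (\<integral>x. \<phi> (- (x \<bullet> w)) \<partial>L)"
        using assms(1) by (intro Bochner_Integration.integral_cong) (auto simp: indicator_def halfspace_def tame_def)
      finally show ?thesis .
    qed
    have "D M = D N"
    proof (rule measure_eqI_lessThan)
      show "emeasure (D M) {t<..} < \<infinity>" for t
        by (simp add: em less_top[symmetric])
      have "min (- b) (- t) < 0" "\<epsilon> * norm w \<le> - min (- b) (- t)" for t
        using w assms(2) by auto
      then show "emeasure (D M) {t<..} = emeasure (D N) {t<..}" for t
        using elim by (simp add: em)
    qed (auto simp: D_def)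
    then show "(\<integral>x. \<phi> (- (x \<bullet> w)) \<partial>M) = (\<integral>x. \<phi> (- (x \<bullet> w)) \<partial>N)"
      using int[OF sets(1)] int[OF sets(2)] by simp
  qed
qed

text \<open>Both integrals depend continuously on \<open>w\<close> by dominated convergence, so the
  null set of directions can be removed: \<open>- w\<close> is a limit of good vectors.\<close>

lemma tame_integral:
  assumes \<phi>: "tame b \<phi>" "b > 0" and w: "\<epsilon> * norm w < b"
  shows "(\<integral>x. \<phi> (x \<bullet> w) \<partial>M) = (\<integral>x. \<phi> (x \<bullet> w) \<partial>N)"
proof -
  have cont: "continuous_on UNIV \<phi>" and gr: "poly_growth \<phi>" using \<phi> by (auto simp: tame_def)
  have [measurable]: "\<phi> \<in> borel_measurable borel" by (rule borel_measurable_continuous_onI) fact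
  \<comment> \<open>The strict inequality is an open condition, so vectors near \<open>- w\<close>
    satisfy it too.\<close>
  have "open {v. \<epsilon> * norm v < b}" by (intro open_Collect_less continuous_intros)
  then have "\<exists>d>0. ball (- w) d \<subseteq> {v. \<epsilon> * norm v < b}"
    by (rule openE[where x = "- w"]) (use w in auto)
  then obtain d where d: "d > 0" "\<And>v. dist (- w) v < d \<Longrightarrow> \<epsilon> * norm v < b"
    by (auto simp: subset_iff)
  have "\<exists>v. dist (- w) v < min d (1 / Suc n) \<and> (\<integral>x. \<phi> (- (x \<bullet> v)) \<partial>M) = (\<integral>x. \<phi> (- (x \<bullet> v)) \<partial>N)" for n
    using AE_lborel_dense[OF tame_integral_AE[OF \<phi>], of "min d (1 / Suc n)" "- w"] d
    by (metis min_less_iff_conj of_nat_0_less_iff zero_less_Suc zero_less_divide_1_iff)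
  then obtain v where v: "\<And>n. dist (- w) (v n) < min d (1 / Suc n)"
    and eq: "\<And>n. (\<integral>x. \<phi> (- (x \<bullet> v n)) \<partial>M) = (\<integral>x. \<phi> (- (x \<bullet> v n)) \<partial>N)"
    by metis
  have "v \<longlonglongrightarrow> - w"
  proof (rule metric_LIMSEQ_I)
    fix r :: real assume "r > 0"
    then obtain k where "inverse (real (Suc k)) < r" using reals_Archimedean by blast
    then have "dist (v n) (- w) < r" if "n \<ge> k" for n
      using v[of n] that by (simp add: dist_commute divide_inverse) 
        (smt (verit) le_imp_inverse_le of_nat_0_le_iff of_nat_le_iff)
    then show "\<exists>k. \<forall>n\<ge>k. dist (v n) (- w) < r" by blast
  qed
  then have vlim: "(\<lambda>n. - (x \<bullet> v n)) \<longlonglongrightarrow> x \<bullet> w" for x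
    using tendsto_minus[OF tendsto_inner[OF tendsto_const[of x]]] by fastforce
  have isc: "isCont \<phi> t" for t
    using cont by (simp add: continuous_on_eq_continuous_at)
  obtain C m where "0 \<le> C" and C: "\<And>x u :: 'a. norm u \<le> norm w + d \<Longrightarrow> \<bar>\<phi> (x \<bullet> u)\<bar> \<le> C * (1 + norm x) ^ m"
    using poly_growth_inner[OF gr, of "norm w + d"] by metis
  have "norm (- v n) \<le> norm w + d" for n
    using v[of n] dist_triangle[of 0 "v n" "- w"] by simp
  from C[OF this] have bound: "norm (\<phi> (- (x \<bullet> v n))) \<le> C * (1 + norm x) ^ m" for x n
    by simp
  have lim: "(\<lambda>n. \<integral>x. \<phi> (- (x \<bullet> v n)) \<partial>L) \<longlonglongrightarrow> (\<integral>x. \<phi> (x \<bullet> w) \<partial>L)" 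
    if [measurable_cong]: "sets L = sets borel" and "integrable L (\<lambda>x. (1 + norm x) ^ m)" for L
  proof (rule integral_dominated_convergence)
    show "integrable L (\<lambda>x. C * (1 + norm x) ^ m)" using that by simp
    show "AE x in L. (\<lambda>n. \<phi> (- (x \<bullet> v n))) \<longlonglongrightarrow> \<phi> (x \<bullet> w)"
      by (intro AE_I2 isCont_tendsto_compose[OF isc] vlim)
  qed (use bound in auto)
  show ?thesis
    using lim[OF sets(1) moments(1)] lim[OF sets(2) moments(2)] by (simp add: eq LIMSEQ_unique)
qed

text \<open>Quantifying over all profiles and all admissible \<open>w\<close> at once is what allows
  an induction on \<open>f\<close>: differentiation passes to another profile and perturbs
  \<open>w\<close>.\<close>

definition ridge_equal :: "('a \<Rightarrow> real) \<Rightarrow> bool" where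
  "ridge_equal f \<longleftrightarrow> (\<forall>b \<phi> w. tame b \<phi> \<longrightarrow> b > 0 \<longrightarrow> \<epsilon> * norm w < b \<longrightarrow>
     (\<integral>x. f x * \<phi> (x \<bullet> w) \<partial>M) = (\<integral>x. f x * \<phi> (x \<bullet> w) \<partial>N))"

text \<open>Differentiating \<open>\<integral> f(x) \<Phi>(x \<bullet> w)\<close> in \<open>w\<close>, where \<open>\<Phi>\<close> is an antiderivative of \<open>\<phi>\<close>, brings down
  a linear factor. This is where all the moments are needed: \<open>\<Phi>\<close> grows even when \<open>\<phi>\<close> does not.\<close>
lemma ridge_equal_mult_inner:
  assumes f: "real_polynomial_function f" "ridge_equal f"
  shows "ridge_equal (\<lambda>x. f x * (x \<bullet> \<xi>))"
  unfolding ridge_equal_def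
proof (intro allI impI)
  fix b \<phi> and w :: 'a assume \<phi>: "tame b \<phi>" and b: "b > 0" and w: "\<epsilon> * norm w < b"
  have contf: "continuous_on UNIV f"
    using f(1) by (simp add: continuous_on_polymonial_function real_polynomial_function_eq)
  have cont: "continuous_on UNIV \<phi>" and gr: "poly_growth \<phi>" using \<phi> by (auto simp: tame_def)
  have [measurable]: "f \<in> borel_measurable borel" "\<phi> \<in> borel_measurable borel"
    by (rule borel_measurable_continuous_onI, fact)+
  obtain \<Phi> where \<Phi>: "tame b \<Phi>" and deriv: "\<And>t. (\<Phi> has_real_derivative \<phi> t) (at t)"
    using tame_antiderivative[OF \<phi>] b by auto
  then have [measurable]: "\<Phi> \<in> borel_measurable borel"
    by (intro borel_measurable_continuous_onI) (auto simp: tame_def)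
  have "open {s::real. \<epsilon> * norm (w + s *\<^sub>R \<xi>) < b}"
    by (intro open_Collect_less continuous_intros)
  then have "\<exists>d>0. ball 0 d \<subseteq> {s. \<epsilon> * norm (w + s *\<^sub>R \<xi>) < b}"
    by (rule openE[where x = 0]) (use w in auto)
  then obtain d where d: "d > 0" "\<And>s. \<bar>s\<bar> < d \<Longrightarrow> \<epsilon> * norm (w + s *\<^sub>R \<xi>) < b"
    by (auto simp: subset_iff)
  \<comment> \<open>The bound \<open>d / 2\<close> keeps \<open>w + s n *\<^sub>R \<xi>\<close>
    admissible; the bound \<open>1\<close> confines the intermediate points of the mean value
    theorem to a fixed ball.\<close>
  define s where "s n = min (d / 2) 1 * inverse (real (Suc n))" for n
  have s: "s n > 0" "s n < d" "s n \<le> 1" for n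
  proof -
    have i: "0 < inverse (real (Suc n))" "inverse (real (Suc n)) \<le> 1" by (auto simp: divide_simps)
    show "s n > 0" unfolding s_def using d(1) i by (intro mult_pos_pos) auto
    have "s n \<le> min (d / 2) 1 * 1" unfolding s_def using d(1) i by (intro mult_left_mono) auto
    then show "s n < d" "s n \<le> 1" using d(1) by auto
  qed
  have slim: "s \<longlonglongrightarrow> 0"
    unfolding s_def using tendsto_mult[OF tendsto_const LIMSEQ_inverse_real_of_nat, of "min (d/2) 1"] by simp
  define q where "q n x = f x * ((\<Phi> (x \<bullet> (w + s n *\<^sub>R \<xi>)) - \<Phi> (x \<bullet> w)) / s n)" for n x
  \<comment> \<open>The mean value theorem bounds the difference quotients uniformly in
    \<open>n\<close>, giving the dominating function \<open>B\<close>.\<close>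
  have mvt: "\<exists>u. norm u \<le> norm w + norm \<xi> \<and>
      (\<Phi> (x \<bullet> (w + s n *\<^sub>R \<xi>)) - \<Phi> (x \<bullet> w)) / s n = (x \<bullet> \<xi>) * \<phi> (x \<bullet> u)" for x n
  proof -
    have "\<exists>z. 0 < z \<and> z < s n \<and> \<Phi> (x \<bullet> (w + s n *\<^sub>R \<xi>)) - \<Phi> (x \<bullet> (w + 0 *\<^sub>R \<xi>))
        = (s n - 0) * (\<phi> (x \<bullet> (w + z *\<^sub>R \<xi>)) * (x \<bullet> \<xi>))"
      by (rule MVT2) (use s in \<open>auto simp: inner_add_right intro!: derivative_eq_intros DERIV_chain2[OF deriv]\<close>)
    then obtain z where z: "0 < z" "z < s n"
      "\<Phi> (x \<bullet> (w + s n *\<^sub>R \<xi>)) - \<Phi> (x \<bullet> w) = s n * (\<phi> (x \<bullet> (w + z *\<^sub>R \<xi>)) * (x \<bullet> \<xi>))"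
      by auto
    have "norm (w + z *\<^sub>R \<xi>) \<le> norm w + norm (z *\<^sub>R \<xi>)" by (rule norm_triangle_ineq)
    also have "norm (z *\<^sub>R \<xi>) \<le> norm \<xi>"
      using z s(3)[of n] by (simp add: mult_left_le_one_le)
    finally show ?thesis using z s(1)[of n] by (intro exI[of _ "w + z *\<^sub>R \<xi>"]) simp
  qed
  obtain C m where "0 \<le> C" and C: "\<And>x u :: 'a. norm u \<le> norm w + norm \<xi> \<Longrightarrow> \<bar>\<phi> (x \<bullet> u)\<bar> \<le> C * (1 + norm x) ^ m"
    using poly_growth_inner[OF gr, of "norm w + norm \<xi>"] by metis
  define B where "B x = \<bar>f x\<bar> * (\<bar>x \<bullet> \<xi>\<bar> * (C * (1 + norm x) ^ m))" for x
  have bound: "norm (q n x) \<le> B x" for n x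
  proof -
    obtain u where u: "norm u \<le> norm w + norm \<xi>" "(\<Phi> (x \<bullet> (w + s n *\<^sub>R \<xi>)) - \<Phi> (x \<bullet> w)) / s n = (x \<bullet> \<xi>) * \<phi> (x \<bullet> u)"
      using mvt by blast
    show ?thesis
      unfolding q_def B_def u(2) real_norm_def abs_mult using C[OF u(1)] by (intro mult_left_mono) auto
  qed
  have "poly_growth (\<lambda>x::'a. (1 + norm x) ^ m)"
    unfolding poly_growth_def by (intro exI[of _ 1] exI[of _ m]) auto
  then have "poly_growth (\<lambda>x. f x * ((x \<bullet> \<xi>) * (C * (1 + norm x) ^ m)))"
    by (intro poly_growth_mult poly_growth_const poly_growth_polynomial[OF f(1)]
        poly_growth_bounded_linear[OF bounded_linear_inner_left])
  then have "poly_growth B"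
    by (rule poly_growth_mono) (simp add: B_def abs_mult \<open>0 \<le> C\<close>)
  then have B: "integrable M B" "integrable N B"
    unfolding B_def by (auto intro!: integrable_poly_growth)
  have lim: "(\<lambda>n. \<integral>x. q n x \<partial>L) \<longlonglongrightarrow> (\<integral>x. f x * (x \<bullet> \<xi>) * \<phi> (x \<bullet> w) \<partial>L)"
    if [measurable_cong]: "sets L = sets borel" and "integrable L B" for L
  proof (rule integral_dominated_convergence)
    show "AE x in L. (\<lambda>n. q n x) \<longlonglongrightarrow> f x * (x \<bullet> \<xi>) * \<phi> (x \<bullet> w)"
    proof (rule AE_I2)
      fix x
      have "((\<lambda>t. \<Phi> (x \<bullet> (w + t *\<^sub>R \<xi>))) has_real_derivative \<phi> (x \<bullet> (w + 0 *\<^sub>R \<xi>)) * (x \<bullet> \<xi>)) (at 0)"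
        by (rule DERIV_chain2[OF deriv]) (auto simp: inner_add_right intro!: derivative_eq_intros)
      then have "(\<lambda>t. (\<Phi> (x \<bullet> (w + t *\<^sub>R \<xi>)) - \<Phi> (x \<bullet> w)) / t) \<midarrow>0\<rightarrow> \<phi> (x \<bullet> w) * (x \<bullet> \<xi>)"
        by (simp add: DERIV_def)
      moreover have "filterlim s (at 0) sequentially"
        using slim s(1) by (auto simp: filterlim_at less_imp_neq[symmetric])
      ultimately have "(\<lambda>n. (\<Phi> (x \<bullet> (w + s n *\<^sub>R \<xi>)) - \<Phi> (x \<bullet> w)) / s n) \<longlonglongrightarrow> \<phi> (x \<bullet> w) * (x \<bullet> \<xi>)"
        by (rule filterlim_compose)
      from tendsto_mult[OF tendsto_const this, of "f x"]
      show "(\<lambda>n. q n x) \<longlonglongrightarrow> f x * (x \<bullet> \<xi>) * \<phi> (x \<bullet> w)" by (simp add: q_def mult_ac)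
    qed
    show "q n \<in> borel_measurable L" for n unfolding q_def by measurable
  qed (use bound that in auto)
  have "(\<integral>x. q n x \<partial>M) = (\<integral>x. q n x \<partial>N)" for n
  proof -
    note gi = integrable_mult_tame[OF f(1) \<Phi>]
    have eq: "(\<integral>x. f x * \<Phi> (x \<bullet> u) \<partial>M) = (\<integral>x. f x * \<Phi> (x \<bullet> u) \<partial>N)" if "\<epsilon> * norm u < b" for u
      using f(2) \<Phi> b that by (simp add: ridge_equal_def)
    have "q n = (\<lambda>x. (f x * \<Phi> (x \<bullet> (w + s n *\<^sub>R \<xi>)) - f x * \<Phi> (x \<bullet> w)) / s n)"
      by (simp add: q_def right_diff_distrib fun_eq_iff)
    then show ?thesis
      using gi eq[OF w] eq[OF d(2)[of "s n"]] s[of n] by simp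
  qed
  then show "(\<integral>x. f x * (x \<bullet> \<xi>) * \<phi> (x \<bullet> w) \<partial>M) = (\<integral>x. f x * (x \<bullet> \<xi>) * \<phi> (x \<bullet> w) \<partial>N)"
    using lim[OF sets(1) B(1)] lim[OF sets(2) B(2)] by (simp add: LIMSEQ_unique)
qed

text \<open>Linear factors are multiplied in one after another, starting from the constant
  \<open>1\<close>, for which \<open>tame_integral\<close> is the claim. The accumulated factor
  \<open>f\<close> is generalized in the induction so that products can be handled.\<close>

lemma ridge_equal_polynomial:
  assumes "real_polynomial_function p"
  shows "ridge_equal p"
proof -
  have "ridge_equal (\<lambda>x. f x * p x)" if "real_polynomial_function p" "real_polynomial_function f" "ridge_equal f" for f p
    using that
  proof (induction p arbitrary: f rule: real_polynomial_function.induct)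
    case (linear h)
    have "h x = x \<bullet> adjoint h 1" for x
      using adjoint_works[OF bounded_linear.linear[OF linear(1)], of x 1] by simp
    then show ?case using ridge_equal_mult_inner[OF linear(2,3)] by simp
  next
    case (const c)
    then show ?case by (simp add: ridge_equal_def mult.commute[of _ c] mult.assoc)
  next
    case (add g h)
    show ?case unfolding ridge_equal_def
    proof (intro allI impI)
      fix b \<phi> and w :: 'a assume *: "tame b \<phi>" "b > 0" "\<epsilon> * norm w < b"
      show "(\<integral>x. f x * (g x + h x) * \<phi> (x \<bullet> w) \<partial>M) = (\<integral>x. f x * (g x + h x) * \<phi> (x \<bullet> w) \<partial>N)"
        using add.IH(1)[OF add.prems] add.IH(2)[OF add.prems] *
          integrable_mult_tame[OF real_polynomial_function.intros(4)[OF add.prems(1) add.hyps(1)] *(1)]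
          integrable_mult_tame[OF real_polynomial_function.intros(4)[OF add.prems(1) add.hyps(2)] *(1)]
        by (simp add: ridge_equal_def distrib_left distrib_right)
    qed
  next
    case (mult g h)
    have "ridge_equal (\<lambda>x. f x * g x)" "real_polynomial_function (\<lambda>x. f x * g x)"
      using mult by (auto intro: real_polynomial_function.intros(4))
    from mult.IH(2)[OF this(2,1)] show ?case by (simp add: mult.assoc)
  qed
  from this[OF assms real_polynomial_function.intros(2)[of 1]] show ?thesis
    using tame_integral by (simp add: ridge_equal_def)
qed

end

section \<open>Projections to planes\<close>

text \<open>A second difference of \<open>max 0 (q - c)\<close>: a triangular bump of height
  \<open>h\<close> supported on the interval from \<open>c\<close> to \<open>c + 2 * h\<close>. In
  this form, identities for truncated parabolas carry over by linearity.\<close>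

definition tent :: "real \<Rightarrow> real \<Rightarrow> real \<Rightarrow> real" where
  "tent c h q = max 0 (q - c) - 2 * max 0 (q - (c + h)) + max 0 (q - (c + 2 * h))"

lemma tent_nonneg: "h > 0 \<Longrightarrow> tent c h q \<ge> 0"
  by (auto simp: tent_def max_def)

lemma tent_le: "h > 0 \<Longrightarrow> tent c h q \<le> h"
  by (auto simp: tent_def max_def)

lemma tent_eq_0_iff: "h > 0 \<Longrightarrow> tent c h q = 0 \<longleftrightarrow> q \<le> c \<or> c + 2 * h \<le> q"
  by (auto simp: tent_def max_def)

lemma tent_measurable [measurable]: "tent c h \<in> borel_measurable borel"
  unfolding tent_def by measurable

context halfspace_pair
begin

text \<open>By Fubini, averaging the identities for \<open>ridge c\<close> over the directions
  \<open>w t\<close> yields the truncated parabola times \<open>semicircle_area\<close>, which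
  cancels. Each \<open>w t\<close> has norm at most \<open>norm u + norm v\<close>, so the second
  assumption on \<open>c\<close> makes all of them admissible.\<close>

lemma integral_truncated_parabola:
  assumes p: "real_polynomial_function p" and c: "c > 0" "\<epsilon> * (norm u + norm v) < sqrt c"
  shows "(\<integral>x. p x * max 0 ((x \<bullet> u)\<^sup>2 + (x \<bullet> v)\<^sup>2 - c) \<partial>M)
    = (\<integral>x. p x * max 0 ((x \<bullet> u)\<^sup>2 + (x \<bullet> v)\<^sup>2 - c) \<partial>N)"
proof -
  have pc: "continuous_on UNIV p"
    using p by (simp add: continuous_on_polymonial_function real_polynomial_function_eq)
  have [measurable]: "p \<in> borel_measurable borel" "ridge c \<in> borel_measurable borel"
    by (rule borel_measurable_continuous_onI, rule pc continuous_on_ridge)+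
  define w where "w t = cos t *\<^sub>R u + sin t *\<^sub>R v" for t
  have [measurable]: "w \<in> borel_measurable borel"
    unfolding w_def by (intro borel_measurable_continuous_onI continuous_intros)
  have nw: "norm (w t) \<le> norm u + norm v" for t
  proof -
    have "norm (w t) \<le> norm (cos t *\<^sub>R u) + norm (sin t *\<^sub>R v)"
      unfolding w_def by (rule norm_triangle_ineq)
    also have "\<dots> \<le> 1 * norm u + 1 * norm v"
      unfolding norm_scaleR by (intro add_mono mult_right_mono) auto
    finally show ?thesis by simp
  qed
  obtain C m where "0 \<le> C" and C: "\<And>x u' :: 'a. norm u' \<le> norm u + norm v \<Longrightarrow> \<bar>ridge c (x \<bullet> u')\<bar> \<le> C * (1 + norm x) ^ m"
    using poly_growth_inner[of "ridge c" "norm u + norm v"] tame_ridge[of c] c(1)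
    by (metis less_imp_le tame_def)
  define B where "B x = \<bar>p x\<bar> * (C * (1 + norm x) ^ m)" for x
  have "poly_growth (\<lambda>x::'a. (1 + norm x) ^ m)"
    unfolding poly_growth_def by (intro exI[of _ 1] exI[of _ m]) auto
  then have "poly_growth (\<lambda>x. p x * (C * (1 + norm x) ^ m))"
    by (intro poly_growth_mult poly_growth_const poly_growth_polynomial[OF p])
  then have "poly_growth B"
    by (rule poly_growth_mono) (simp add: B_def abs_mult \<open>0 \<le> C\<close>)
  moreover have Bm [measurable]: "B \<in> borel_measurable borel" unfolding B_def by measurable
  ultimately have B: "integrable M B" "integrable N B" by (auto intro!: integrable_poly_growth)
  define f where "f x t = indicator {-pi..pi} t *\<^sub>R (p x * ridge c (x \<bullet> w t))" for x t
  have swap: "(\<integral>t. (\<integral>x. f x t \<partial>L) \<partial>lborel) =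
      semicircle_area * (\<integral>x. p x * max 0 ((x \<bullet> u)\<^sup>2 + (x \<bullet> v)\<^sup>2 - c) \<partial>L)"
    if L: "finite_measure L" and [measurable_cong]: "sets L = sets borel" and B: "integrable L B" for L
  proof -
    interpret L: finite_measure L by fact
    interpret LL: pair_sigma_finite L "lborel :: real measure" ..
    have "integrable (L \<Otimes>\<^sub>M lborel) (\<lambda>(x, t). B x * indicator {-pi..pi} t)"
    proof (rule LL.Fubini_integrable)
      show "integrable L (\<lambda>x. \<integral>t. norm (case (x, t) of (x, t) \<Rightarrow> B x * indicator {-pi..pi} t) \<partial>lborel)"
        using B by (simp add: abs_mult)
    qed auto
    then have "integrable (L \<Otimes>\<^sub>M lborel) (case_prod f)"
    proof (rule Bochner_Integration.integrable_bound)
      show "AE z in L \<Otimes>\<^sub>M lborel. norm (case_prod f z) \<le> norm (case z of (x, t) \<Rightarrow> B x * indicator {-pi..pi} t)"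
      proof (rule AE_I2, clarify)
        fix x t
        show "norm (f x t) \<le> norm (B x * indicator {-pi..pi} t)"
          using mult_left_mono[OF C[OF nw, of x t], of "\<bar>p x\<bar>"] \<open>0 \<le> C\<close>
          by (auto simp: f_def B_def indicator_def abs_mult)
      qed
      show "case_prod f \<in> borel_measurable (L \<Otimes>\<^sub>M lborel)"
        unfolding f_def by measurable
    qed
    then have "(\<integral>t. (\<integral>x. f x t \<partial>L) \<partial>lborel) = (\<integral>x. (\<integral>t. f x t \<partial>lborel) \<partial>L)"
      by (rule LL.Fubini_integral)
    moreover have "(\<integral>t. f x t \<partial>lborel) = semicircle_area * (p x * max 0 ((x \<bullet> u)\<^sup>2 + (x \<bullet> v)\<^sup>2 - c))" for x
    proof -
      have "continuous_on {-pi..pi} (\<lambda>t. p x * ridge c (x \<bullet> w t))"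
        unfolding w_def
        by (intro continuous_intros continuous_on_compose2[OF continuous_on_ridge[of UNIV]]) auto
      then have "set_integrable lborel {-pi..pi} (\<lambda>t. p x * ridge c (x \<bullet> w t))"
        by (rule borel_integrable_atLeastAtMost')
      then have "(\<integral>t. f x t \<partial>lborel) = integral {-pi..pi} (\<lambda>t. p x * ridge c (x \<bullet> w t))"
        unfolding f_def by (rule set_borel_integral_eq_integral(2)[unfolded set_lebesgue_integral_def])
      also have "\<dots> = p x * integral {-pi..pi} (\<lambda>t. ridge c ((x \<bullet> u) * cos t + (x \<bullet> v) * sin t))"
        by (simp add: w_def inner_add_right mult.commute)
      also have "\<dots> = semicircle_area * (p x * max 0 ((x \<bullet> u)\<^sup>2 + (x \<bullet> v)\<^sup>2 - c))"
        using c by (simp add: integral_ridge_circle)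
      finally show ?thesis .
    qed
    ultimately show ?thesis by simp
  qed
  have "(\<integral>x. f x t \<partial>M) = (\<integral>x. f x t \<partial>N)" for t
  proof -
    have "\<epsilon> * norm (w t) < sqrt c"
      using mult_left_mono[OF nw eps, of t] c(2) by linarith
    then have "(\<integral>x. p x * ridge c (x \<bullet> w t) \<partial>M) = (\<integral>x. p x * ridge c (x \<bullet> w t) \<partial>N)"
      using ridge_equal_polynomial[OF p] tame_ridge[of c] c(1) unfolding ridge_equal_def by force
    then show ?thesis by (simp add: f_def)
  qed
  then show ?thesis
    using swap[OF fin(1) sets(1) B(1)] swap[OF fin(2) sets(2) B(2)] semicircle_area_pos by simp
qed

lemma integral_tent:
  assumes p: "real_polynomial_function p" and c: "c > 0" "h > 0" "\<epsilon> * (norm u + norm v) < sqrt c"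
  shows "(\<integral>x. p x * tent c h ((x \<bullet> u)\<^sup>2 + (x \<bullet> v)\<^sup>2) \<partial>M)
    = (\<integral>x. p x * tent c h ((x \<bullet> u)\<^sup>2 + (x \<bullet> v)\<^sup>2) \<partial>N)"
proof -
  define P where "P b x = p x * max 0 ((x \<bullet> u)\<^sup>2 + (x \<bullet> v)\<^sup>2 - b)" for b x
  have lin: "real_polynomial_function (\<lambda>x::'a. x \<bullet> y)" for y
    by (rule real_polynomial_function.intros(1)) (rule bounded_linear_inner_left)
  have int: "integrable M (P b)" "integrable N (P b)" if "b > 0" for b
  proof -
    have "continuous_on UNIV p"
      using p by (simp add: continuous_on_polymonial_function real_polynomial_function_eq)
    then have [measurable]: "p \<in> borel_measurable borel"
      by (rule borel_measurable_continuous_onI)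
    have "poly_growth (\<lambda>x. p x * ((x \<bullet> u)\<^sup>2 + (x \<bullet> v)\<^sup>2))"
      by (intro poly_growth_polynomial real_polynomial_function.intros(3,4) p
          real_polynomial_function_power lin)
    then have "poly_growth (P b)"
      by (rule poly_growth_mono) (use \<open>b > 0\<close> in \<open>auto simp: P_def abs_mult intro!: mult_left_mono\<close>)
    moreover have "P b \<in> borel_measurable borel" unfolding P_def by measurable
    ultimately show "integrable M (P b)" "integrable N (P b)"
      by (auto intro!: integrable_poly_growth)
  qed
  have eq: "(\<integral>x. P b x \<partial>M) = (\<integral>x. P b x \<partial>N)" if "b \<ge> c" for b
    unfolding P_def using that c real_sqrt_le_mono[OF that]
    by (intro integral_truncated_parabola[OF p]) linarith+
  have "p x * tent c h ((x \<bullet> u)\<^sup>2 + (x \<bullet> v)\<^sup>2) = P c x - 2 * P (c + h) x + P (c + 2 * h) x" for x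
    by (simp add: tent_def P_def algebra_simps)
  then show ?thesis
    using c int[of c] int[of "c + h"] int[of "c + 2 * h"] eq[of c] eq[of "c + h"] eq[of "c + 2 * h"] by simp
qed

text \<open>A polynomial on the plane pulls back to a polynomial in \<open>x\<close>, so all moments
  of the two images agree. The tent weight confines the images to a disc, where moments determine a
  measure.\<close>

lemma distr_tent_eq:
  assumes c: "c > 0" "h > 0" "\<epsilon> * (norm u + norm v) < sqrt c"
  shows "distr (density M (\<lambda>x. ennreal (tent c h ((x \<bullet> u)\<^sup>2 + (x \<bullet> v)\<^sup>2)))) borel (\<lambda>x. (x \<bullet> u, x \<bullet> v))
       = distr (density N (\<lambda>x. ennreal (tent c h ((x \<bullet> u)\<^sup>2 + (x \<bullet> v)\<^sup>2)))) borel (\<lambda>x. (x \<bullet> u, x \<bullet> v))"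
proof -
  define T where "T x = tent c h ((x \<bullet> u)\<^sup>2 + (x \<bullet> v)\<^sup>2)" for x
  define F where "F = (\<lambda>x. (x \<bullet> u, x \<bullet> v))"
  define D where "D L = distr (density L (\<lambda>x. ennreal (T x))) borel F" for L
  have [measurable]: "T \<in> borel_measurable borel" unfolding T_def by measurable
  have F [measurable]: "F \<in> borel_measurable borel" 
    unfolding F_def by (intro borel_measurable_continuous_onI continuous_intros)
  have Tint: "integrable M T" "integrable N T"
    by (rule M.integrable_const_bound[of _ h] N.integrable_const_bound[of _ h];
        use tent_nonneg[OF c(2)] tent_le[OF c(2)] in \<open>auto simp: T_def\<close>)+
  let ?K = "cball (0::real \<times> real) (sqrt (c + 2 * h))"
  have null: "emeasure (D L) (- ?K) = 0" if [measurable_cong]: "sets L = sets borel" for L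
  proof -
    have "T x = 0" if "F x \<in> - ?K" for x
      using that c by (auto simp: T_def F_def tent_eq_0_iff norm_Pair)
    then have "(\<integral>\<^sup>+x. ennreal (T x) * indicator (F -` (- ?K)) x \<partial>L) = (\<integral>\<^sup>+x. 0 \<partial>L)"
      by (intro nn_integral_cong) (auto simp: indicator_def)
    moreover have "F -` (- ?K) \<in> sets L"
      using measurable_sets[OF F, of "- ?K"] by (simp add: that)
    ultimately show ?thesis
      using sets_eq_imp_space_eq[OF that] by (simp add: D_def emeasure_distr emeasure_density)
  qed
  have fin: "finite_measure (D L)" if [measurable_cong]: "sets L = sets borel" and "integrable L T" for L
  proof (rule finite_measureI)
    have "emeasure (D L) (space (D L)) = (\<integral>\<^sup>+x. ennreal (T x) \<partial>L)"
      using sets_eq_imp_space_eq[OF that(1)]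
      by (simp add: D_def emeasure_distr emeasure_density cong: nn_integral_cong)
    also have "\<dots> < \<infinity>"
      using that(2) tent_nonneg[OF c(2)] by (subst nn_integral_eq_integral) (auto simp: T_def)
    finally show "emeasure (D L) (space (D L)) \<noteq> \<infinity>" by simp
  qed
  have "D M = D N"
  proof (rule measure_eqI_moments)
    fix p :: "real \<times> real \<Rightarrow> real" assume p: "real_polynomial_function p"
    then have "continuous_on UNIV p"
      by (simp add: continuous_on_polymonial_function real_polynomial_function_eq)
    then have [measurable]: "p \<in> borel_measurable borel"
      by (rule borel_measurable_continuous_onI)
    have "polynomial_function F"
      unfolding F_def
      by (intro polynomial_function_bounded_linear bounded_linear_Pair bounded_linear_inner_left)
    from real_polynomial_function_compose[OF this p]
    have pF: "real_polynomial_function (\<lambda>x. p (F x))" by (simp add: o_def)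
    have "(\<integral>y. p y \<partial>D L) = (\<integral>x. p (F x) * T x \<partial>L)" if [measurable_cong]: "sets L = sets borel" for L
      unfolding D_def using tent_nonneg[OF c(2)]
      by (simp add: integral_distr integral_density T_def mult.commute)
    from this[OF sets(1)] this[OF sets(2)] integral_tent[OF pF c]
    show "(\<integral>y. p y \<partial>D M) = (\<integral>y. p y \<partial>D N)" by (simp add: T_def)
  next
    show "finite_measure (D M)" "finite_measure (D N)" by (intro fin Tint sets)+
    show "emeasure (D M) (- ?K) = 0" "emeasure (D N) (- ?K) = 0" by (intro null sets)+
  qed (auto simp: D_def)
  then show ?thesis by (simp add: D_def T_def F_def)
qed

text \<open>Integrating \<open>G / T n\<close> against the weighted image undoes the tent weight and
  gives the integral of \<open>G\<close> over an annulus. The annuli exhaust the exterior of the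
  disc where \<open>G\<close> vanishes.\<close>

lemma plane_integral_eq:
  fixes G :: "real \<times> real \<Rightarrow> real"
  assumes c: "c > 0" "\<epsilon> * (norm u + norm v) < sqrt c"
    and G [measurable]: "G \<in> borel_measurable borel"
    and bound: "\<And>y. \<bar>G y\<bar> \<le> B" and supp: "\<And>y. (fst y)\<^sup>2 + (snd y)\<^sup>2 \<le> c \<Longrightarrow> G y = 0"
  shows "(\<integral>x. G (x \<bullet> u, x \<bullet> v) \<partial>M) = (\<integral>x. G (x \<bullet> u, x \<bullet> v) \<partial>N)"
proof -
  define T where "T n y = tent c (real (Suc n)) ((fst y)\<^sup>2 + (snd y)\<^sup>2)" for n and y :: "real \<times> real"
  \<comment> \<open>Where the weight is zero, so is its product with the quotient; hence
    \<open>g n\<close> and not \<open>G\<close>.\<close>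
  define g where "g n y = (if T n y = 0 then 0 else G y)" for n y
  have [measurable]: "T n \<in> borel_measurable borel" for n
    unfolding T_def
    by (rule measurable_compose[OF _ tent_measurable])
      (intro borel_measurable_continuous_onI continuous_intros)
  have [measurable]: "g n \<in> borel_measurable borel" for n
    unfolding g_def by measurable
  have F [measurable]: "(\<lambda>x. (x \<bullet> u, x \<bullet> v)) \<in> borel_measurable borel" 
    by (intro borel_measurable_continuous_onI continuous_intros)
  have "(\<integral>y. G y / T n y \<partial>distr (density L (\<lambda>x. ennreal (T n (x \<bullet> u, x \<bullet> v)))) borel (\<lambda>x. (x \<bullet> u, x \<bullet> v)))
      = (\<integral>x. g n (x \<bullet> u, x \<bullet> v) \<partial>L)" if [measurable_cong]: "sets L = sets borel" for L n
  proof -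
    have "0 \<le> T n y" for y unfolding T_def by (rule tent_nonneg) simp
    then have "(\<integral>y. G y / T n y \<partial>distr (density L (\<lambda>x. ennreal (T n (x \<bullet> u, x \<bullet> v)))) borel (\<lambda>x. (x \<bullet> u, x \<bullet> v)))
      = (\<integral>x. T n (x \<bullet> u, x \<bullet> v) *\<^sub>R (G (x \<bullet> u, x \<bullet> v) / T n (x \<bullet> u, x \<bullet> v)) \<partial>L)"
      by (subst integral_distr) (auto simp: integral_density)
    also have "\<dots> = (\<integral>x. g n (x \<bullet> u, x \<bullet> v) \<partial>L)"
      by (intro Bochner_Integration.integral_cong) (auto simp: g_def)
    finally show ?thesis .
  qed
  from this[OF sets(1)] this[OF sets(2)] distr_tent_eq[OF c(1) _ c(2)]
  have eq: "(\<integral>x. g n (x \<bullet> u, x \<bullet> v) \<partial>M) = (\<integral>x. g n (x \<bullet> u, x \<bullet> v) \<partial>N)" for n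
    by (simp add: T_def del: of_nat_Suc)
  have lim: "(\<lambda>n. \<integral>x. g n (x \<bullet> u, x \<bullet> v) \<partial>L) \<longlonglongrightarrow> (\<integral>x. G (x \<bullet> u, x \<bullet> v) \<partial>L)"
    if "finite_measure L" and [measurable_cong]: "sets L = sets borel" for L
  proof (rule integral_dominated_convergence)
    interpret L: finite_measure L by fact
    show "integrable L (\<lambda>_. B)" by simp
    have "(\<lambda>n. g n y) \<longlonglongrightarrow> G y" for y
    proof -
      obtain k :: nat where k: "(fst y)\<^sup>2 + (snd y)\<^sup>2 < real k" using reals_Archimedean2 by blast
      have "g n y = G y" if "n \<ge> k" for n
      proof -
        have "real k \<le> real n" using that by simp
        with k c(1) have "(fst y)\<^sup>2 + (snd y)\<^sup>2 < c + 2 * real (Suc n)" by simp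
        then show ?thesis using supp[of y] by (auto simp: g_def T_def tent_eq_0_iff)
      qed
      then have "eventually (\<lambda>n. g n y = G y) sequentially" by (auto simp: eventually_sequentially)
      then show ?thesis by (rule tendsto_eventually)
    qed
    then show "AE x in L. (\<lambda>n. g n (x \<bullet> u, x \<bullet> v)) \<longlonglongrightarrow> G (x \<bullet> u, x \<bullet> v)" by simp
    have "0 \<le> B" using bound[of 0] by linarith
    then show "AE x in L. norm (g n (x \<bullet> u, x \<bullet> v)) \<le> B" for n
      using bound by (auto simp: g_def)
  qed auto
  show ?thesis using lim[OF fin(1) sets(1)] lim[OF fin(2) sets(2)] by (simp add: eq LIMSEQ_unique)
qed

end

section \<open>Tail moments and halfspaces\<close>

text \<open>The cover is made disjoint and countable additivity applies. This works with infinite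
  values, which is essential because the masses near the origin may be infinite.\<close>

lemma emeasure_eq_countable_cover:
  fixes M N :: "'a::topological_space measure"
  assumes [simp]: "sets M = sets borel" "sets N = sets borel"
    and "countable \<C>" and C: "\<And>C. C \<in> \<C> \<Longrightarrow> C \<in> sets borel"
    and eq: "\<And>C A. C \<in> \<C> \<Longrightarrow> A \<in> sets borel \<Longrightarrow> A \<subseteq> C \<Longrightarrow> emeasure M A = emeasure N A"
    and A: "A \<in> sets borel" "A \<subseteq> \<Union>\<C>"
  shows "emeasure M A = emeasure N A"
proof (cases "\<C> = {}")
  case False
  define D where "D n = from_nat_into \<C> n" for n
  have D: "D n \<in> \<C>" for n
    unfolding D_def using False by (rule from_nat_into)
  define E where "E n = A \<inter> disjointed D n" for n
  have "range D \<subseteq> sets borel" using C[OF D] by blast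
  then have "disjointed D n \<in> sets borel" for n
    using sets.range_disjointed_sets[of D borel] by blast
  then have E: "range E \<subseteq> sets borel"
    unfolding E_def using A(1) by blast
  have dis: "disjoint_family E"
    using disjoint_family_disjointed[of D] by (auto simp: E_def disjoint_family_on_def)
  have "(\<Union>n. disjointed D n) = \<Union>\<C>"
    using range_from_nat_into[OF False \<open>countable \<C>\<close>] unfolding UN_disjointed_eq D_def by simp
  moreover have "(\<Union>n. E n) = A \<inter> (\<Union>n. disjointed D n)" unfolding E_def by blast
  ultimately have un: "(\<Union>n. E n) = A"
    using A(2) by (simp add: Int_absorb2)
  have "E n \<subseteq> D n" for n
    unfolding E_def using disjointed_subset[of D n] by blast
  then have "emeasure M (E n) = emeasure N (E n)" for n
    by (intro eq[OF D[of n]]) (use E in auto)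
  then have "(\<Sum>n. emeasure M (E n)) = (\<Sum>n. emeasure N (E n))" by simp
  moreover have "(\<Sum>n. emeasure M (E n)) = emeasure M A"
    unfolding un[symmetric] by (rule suminf_emeasure) (use E dis in simp_all)
  moreover have "(\<Sum>n. emeasure N (E n)) = emeasure N A"
    unfolding un[symmetric] by (rule suminf_emeasure) (use E dis in simp_all)
  ultimately show ?thesis by simp
qed (use A in auto)

section \<open>From almost every halfspace to every offset\<close>

lemma halfspace_scale:
  assumes "w \<noteq> 0"
  shows "halfspace w p = halfspace (w /\<^sub>R norm w) (p / norm w)"
  using assms by (simp add: halfspace_def inverse_eq_divide divide_less_cancel)

text \<open>Fubini gives, for almost every \<open>w\<close>, almost every offset. A halfspace is the
  increasing union of those with good offsets approaching from below, so continuity of measures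
  yields every offset.\<close>

lemma AE_halfspace_all_offsets:
  fixes M N :: "'a::euclidean_space measure"
  assumes [simp]: "sets M = sets borel" "sets N = sets borel"
    and AE: "AE z in (lborel :: ('a \<times> real) measure). fst z \<noteq> 0 \<and> snd z < 0 \<longrightarrow>
      emeasure M (halfspace (fst z /\<^sub>R norm (fst z)) (snd z)) = emeasure N (halfspace (fst z /\<^sub>R norm (fst z)) (snd z))"
  shows "AE w in lborel. \<forall>p<0. emeasure M (halfspace w p) = emeasure N (halfspace w p)"
proof -
  have "AE w in lborel. AE p in (lborel :: real measure). w \<noteq> 0 \<and> p < 0 \<longrightarrow>
      emeasure M (halfspace (w /\<^sub>R norm w) p) = emeasure N (halfspace (w /\<^sub>R norm w) p)"
    using lborel_pair.AE_pair[OF AE[unfolded lborel_prod[symmetric]]] by simp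
  then show ?thesis
  proof eventually_elim
    case (elim w)
    show ?case
    proof (intro allI impI)
      fix p :: real assume p: "p < 0"
      show "emeasure M (halfspace w p) = emeasure N (halfspace w p)"
      proof (cases "w = 0")
        case True
        then have "halfspace w p = {}" using p by (auto simp: halfspace_def)
        then show ?thesis by simp
      next
        case False
        define u where "u = w /\<^sub>R norm w"
        define r where "r = p / norm w"
        have r: "r < 0" using p False by (simp add: r_def divide_neg_pos)
        \<comment> \<open>Choosing the offsets from consecutive disjoint windows makes the sequence
          increasing without further selection.\<close>
        have "\<exists>q. (w \<noteq> 0 \<and> q < 0 \<longrightarrow> emeasure M (halfspace u q) = emeasure N (halfspace u q)) \<and>
            r - 1 / real (n + 1) < q \<and> q < r - 1 / real (n + 2)" for n
        proof -
          define s where "s = 1 / real (n + 1)"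
          define t where "t = 1 / real (n + 2)"
          have "t < s" unfolding s_def t_def by (simp add: field_simps)
          then have "(s - t) / 2 > 0" by simp
          from AE_lborel_dense[OF elim this, of "r - (s + t) / 2"]
          obtain q where "w \<noteq> 0 \<and> q < 0 \<longrightarrow> emeasure M (halfspace u q) = emeasure N (halfspace u q)"
            "dist (r - (s + t) / 2) q < (s - t) / 2"
            unfolding u_def by blast
          moreover from this(2) have "r - s < q" "q < r - t"
            unfolding dist_real_def abs_less_iff by (auto simp: field_simps)
          ultimately show ?thesis unfolding s_def t_def by blast
        qed
        then obtain q where q: "\<And>n. w \<noteq> 0 \<and> q n < 0 \<longrightarrow> emeasure M (halfspace u (q n)) = emeasure N (halfspace u (q n))"
          "\<And>n. r - 1 / real (n + 1) < q n" "\<And>n. q n < r - 1 / real (n + 2)" by metis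
        have qr: "q n < r" for n
        proof -
          have "0 < 1 / real (n + 2)" by simp
          with q(3)[of n] show ?thesis by linarith
        qed
        have eq: "emeasure M (halfspace u (q n)) = emeasure N (halfspace u (q n))" for n
          using q(1)[of n] qr[of n] r False by simp
        have "q n \<le> q (Suc n)" for n
          using q(3)[of n] q(2)[of "Suc n"] by simp
        then have inc: "incseq (\<lambda>n. halfspace u (q n))"
          by (intro incseq_SucI) (auto simp: halfspace_def intro: less_le_trans)
        have un: "(\<Union>n. halfspace u (q n)) = halfspace u r"
        proof (intro set_eqI iffI)
          fix x assume "x \<in> (\<Union>n. halfspace u (q n))"
          then show "x \<in> halfspace u r" using qr by (auto simp: halfspace_def intro: less_trans)
        next
          fix x assume "x \<in> halfspace u r"
          then have "0 < r - x \<bullet> u" by (simp add: halfspace_def)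
          then obtain n where "inverse (real (Suc n)) < r - x \<bullet> u" using reals_Archimedean by blast
          then have "x \<bullet> u < q n" using q(2)[of n] by (simp add: inverse_eq_divide)
          then show "x \<in> (\<Union>n. halfspace u (q n))" by (auto simp: halfspace_def)
        qed
        have "emeasure M (halfspace u r) = (SUP n. emeasure M (halfspace u (q n)))"
          using SUP_emeasure_incseq[of "\<lambda>n. halfspace u (q n)" M] inc by (simp add: un image_subset_iff)
        also have "\<dots> = (SUP n. emeasure N (halfspace u (q n)))" by (simp add: eq)
        also have "\<dots> = emeasure N (halfspace u r)"
          using SUP_emeasure_incseq[of "\<lambda>n. halfspace u (q n)" N] inc by (simp add: un image_subset_iff)
        finally show ?thesis by (simp add: halfspace_scale[OF False] u_def r_def)
      qed
    qed
  qed
qed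

section \<open>Moments of the tails\<close>

lemma emeasure_tail_le:
  assumes "cutoff_family chi" and [measurable_cong, simp]: "sets M = sets borel" and "r > 1"
  shows "emeasure M {x. r < norm x} \<le> (\<integral>\<^sup>+x. ennreal (chi r x) \<partial>M)"
proof -
  have [measurable]: "{x. r < norm x} \<in> sets borel" by measurable
  have "emeasure M {x. r < norm x} = (\<integral>\<^sup>+x. indicator {x. r < norm x} x \<partial>M)"
    by simp
  also have "\<dots> \<le> (\<integral>\<^sup>+x. ennreal (chi r x) \<partial>M)"
    using assms by (intro nn_integral_mono) (auto simp: cutoff_family_def indicator_def)
  finally show ?thesis .
qed

text \<open>The region up to radius \<open>k\<close> lies in a compact shell \<open>K\<close>.
  Beyond it, unit shells are used: a weight of order \<open>n ^ m\<close> against a mass of order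
  \<open>n ^ (- m - 2)\<close> leaves a convergent sum of inverse squares.\<close>

lemma tail_moment_finite:
  fixes M :: "'a::euclidean_space measure"
  assumes sets [measurable_cong, simp]: "sets M = sets borel"
    and compact: "\<And>K. compact K \<Longrightarrow> 0 \<notin> K \<Longrightarrow> emeasure M K < \<infinity>"
    and tail: "\<And>m. m > 0 \<Longrightarrow> \<exists>C R. \<forall>r\<ge>R. emeasure M {x. r < norm x} \<le> ennreal (C * r powr (- m))"
    and "\<epsilon> > 0"
  shows "(\<integral>\<^sup>+x. ennreal ((1 + norm x) ^ m) * indicator {x. \<epsilon> < norm x} x \<partial>M) < \<infinity>"
proof -
  obtain C R where CR: "\<And>r. r \<ge> R \<Longrightarrow> emeasure M {x. r < norm x} \<le> ennreal (C * r powr (- (real m + 2)))"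
    using tail[of "real m + 2"] by auto
  \<comment> \<open>Besides reaching the range of the decay estimate, \<open>k \<ge> 1\<close> gives
    \<open>n + k + 2 \<le> 3 * (n + k)\<close> below.\<close>
  obtain k :: nat where k: "real k \<ge> max R 1" using real_arch_simple by blast
  define K where "K = cball 0 (real k) - ball (0::'a) \<epsilon>"
  have K: "compact K" "0 \<notin> K"
    using \<open>\<epsilon> > 0\<close> by (auto simp: K_def intro!: compact_diff)
  have [measurable]: "K \<in> sets borel" using K(1) by (rule borel_compact)
  define T where "T n = {x::'a. real (n + k) < norm x}" for n
  have [measurable]: "T n \<in> sets borel" for n unfolding T_def by measurable
  \<comment> \<open>Bounds \<open>(1 + norm x) ^ m\<close> on the shell
    \<open>n + k < norm x \<le> n + k + 1\<close>.\<close>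
  define c where "c n = (real (n + k) + 2) ^ m" for n
  have c: "c n \<ge> 0" for n by (simp add: c_def)
  have pointwise: "ennreal ((1 + norm x) ^ m) * indicator {x. \<epsilon> < norm x} x
      \<le> ennreal ((1 + real k) ^ m) * indicator K x + (\<Sum>n. ennreal (c n) * indicator (T n) x)" for x
  proof (cases "\<epsilon> < norm x")
    case True
    show ?thesis
    proof (cases "norm x \<le> real k")
      case le: True
      then have "ennreal ((1 + norm x) ^ m) \<le> ennreal ((1 + real k) ^ m)"
        by (intro ennreal_leI power_mono) auto
      moreover have "x \<in> K" using le True by (auto simp: K_def)
      ultimately show ?thesis using True by (simp add: add_increasing2)
    next
      case False
      \<comment> \<open>Ceiling minus one rather than floor, since membership in \<open>T n\<close>
        is strict even when \<open>norm x\<close> is an integer.\<close>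
      define n where "n = nat (\<lceil>norm x\<rceil> - 1) - k"
      have "real k < norm x" using False by simp
      then have "\<lceil>norm x\<rceil> - 1 \<ge> int k" by linarith
      then have "real (n + k) = of_int \<lceil>norm x\<rceil> - 1"
        unfolding n_def by (simp add: of_nat_diff nat_le_iff le_nat_iff)
      then have n: "real (n + k) < norm x" "norm x \<le> real (n + k) + 1" by linarith+
      have "ennreal ((1 + norm x) ^ m) \<le> ennreal (c n) * indicator (T n) x"
        using n by (auto simp: T_def c_def intro!: ennreal_leI power_mono)
      also have "\<dots> \<le> (\<Sum>i. ennreal (c i) * indicator (T i) x)"
      proof -
        have "f n \<le> suminf f" for f :: "nat \<Rightarrow> ennreal"
          using sum_le_suminf[of f "{n}"] by simp
        then show ?thesis .
      qed
      finally show ?thesis using True by (simp add: add_increasing)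
    qed
  qed simp
  have "(\<integral>\<^sup>+x. ennreal ((1 + norm x) ^ m) * indicator {x. \<epsilon> < norm x} x \<partial>M)
      \<le> (\<integral>\<^sup>+x. ennreal ((1 + real k) ^ m) * indicator K x + (\<Sum>n. ennreal (c n) * indicator (T n) x) \<partial>M)"
    by (intro nn_integral_mono pointwise)
  also have "\<dots> = ennreal ((1 + real k) ^ m) * emeasure M K + (\<Sum>n. ennreal (c n) * emeasure M (T n))"
    by (simp add: nn_integral_add nn_integral_suminf nn_integral_cmult)
  also have "\<dots> < \<infinity>"
  proof -
    have bnd: "ennreal (c n) * emeasure M (T n) \<le> ennreal (3 ^ m * \<bar>C\<bar> * (1 / real (n + k) ^ 2))" for n
    proof -
      have nk: "real (n + k) \<ge> 1" "real (n + k) \<ge> R" using k by auto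
      have "emeasure M (T n) \<le> ennreal (C * real (n + k) powr (- (real m + 2)))"
        unfolding T_def by (rule CR) fact
      also have "\<dots> \<le> ennreal (\<bar>C\<bar> * real (n + k) powr (- (real m + 2)))"
        by (intro ennreal_leI mult_right_mono) auto
      also have "real (n + k) powr (- (real m + 2)) = 1 / real (n + k) ^ (m + 2)"
        using nk(1) powr_realpow[of "real (n + k)" "m + 2"] powr_minus[of "real (n + k)" "real m + 2"]
        by (simp only: inverse_eq_divide of_nat_add[of m 2] of_nat_numeral)
      finally have "ennreal (c n) * emeasure M (T n) \<le> ennreal (c n) * ennreal (\<bar>C\<bar> * (1 / real (n + k) ^ (m + 2)))"
        by (rule mult_left_mono) simp
      also have "\<dots> = ennreal (c n * (\<bar>C\<bar> * (1 / real (n + k) ^ (m + 2))))"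
        by (rule ennreal_mult'[symmetric]) (rule c)
      also have "\<dots> \<le> ennreal ((3 * real (n + k)) ^ m * (\<bar>C\<bar> * (1 / real (n + k) ^ (m + 2))))"
        unfolding c_def using nk(1) by (intro ennreal_leI mult_right_mono power_mono) auto
      also have "(3 * real (n + k)) ^ m * (\<bar>C\<bar> * (1 / real (n + k) ^ (m + 2))) = 3 ^ m * \<bar>C\<bar> * (1 / real (n + k) ^ 2)"
      proof -
        have "real (n + k) ^ m \<noteq> 0" using nk(1) by simp
        then show ?thesis unfolding power_mult_distrib power_add by simp
      qed
      finally show ?thesis .
    qed
    have "summable (\<lambda>n. inverse (real n ^ 2))" by (rule inverse_power_summable) simp
    then have "summable (\<lambda>n. 1 / real (n + k) ^ 2)"
      by (subst summable_iff_shift[of "\<lambda>n. 1 / real n ^ 2"]) (simp add: divide_inverse)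
    then have "summable (\<lambda>n. 3 ^ m * \<bar>C\<bar> * (1 / real (n + k) ^ 2))" by (rule summable_mult)
    then have "(\<Sum>n. ennreal (3 ^ m * \<bar>C\<bar> * (1 / real (n + k) ^ 2))) \<noteq> top"
      by (rule ennreal_suminf_neq_top) simp
    moreover have "(\<Sum>n. ennreal (c n) * emeasure M (T n)) \<le> (\<Sum>n. ennreal (3 ^ m * \<bar>C\<bar> * (1 / real (n + k) ^ 2)))"
      by (intro suminf_le bnd) auto
    ultimately have "(\<Sum>n. ennreal (c n) * emeasure M (T n)) < top"
      by (auto simp: less_top intro: le_less_trans)
    moreover have "ennreal ((1 + real k) ^ m) * emeasure M K < top"
      using compact[OF K] by (simp add: ennreal_mult_less_top)
    ultimately show ?thesis by simp
  qed
  finally show ?thesis .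
qed

section \<open>Uniqueness away from the origin\<close>

text \<open>The masses near the origin may be infinite; they are avoided by applying
  \<open>halfspace_pair\<close> to the restrictions \<open>outer \<epsilon>\<close>, with
  \<open>\<epsilon>\<close> adapted to each claim.\<close>

locale punctured_pair =
  fixes M N :: "'a::euclidean_space measure"
  assumes sets [simp, measurable_cong]: "sets M = sets borel" "sets N = sets borel"
    and tail_moments: "\<And>\<epsilon> m. \<epsilon> > 0 \<Longrightarrow> (\<integral>\<^sup>+x. ennreal ((1 + norm x) ^ m) * indicator {x. \<epsilon> < norm x} x \<partial>M) < \<infinity>"
      "\<And>\<epsilon> m. \<epsilon> > 0 \<Longrightarrow> (\<integral>\<^sup>+x. ennreal ((1 + norm x) ^ m) * indicator {x. \<epsilon> < norm x} x \<partial>N) < \<infinity>"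
    and halfspaces: "AE w in lborel. \<forall>p<0. emeasure M (halfspace w p) = emeasure N (halfspace w p)"
begin

definition outer :: "real \<Rightarrow> 'a measure \<Rightarrow> 'a measure" where
  "outer \<epsilon> L = density L (indicator {x. \<epsilon> < norm x})"

lemma halfspace_pair_outer:
  assumes "\<epsilon> > 0"
  shows "halfspace_pair (outer \<epsilon> M) (outer \<epsilon> N) \<epsilon>"
proof (rule halfspace_pair.intro)
  have ms [measurable]: "{x::'a. \<epsilon> < norm x} \<in> sets borel" by measurable
  have int: "integrable (outer \<epsilon> L) (\<lambda>x. (1 + norm x) ^ m)"
    if [measurable_cong]: "sets L = sets borel"
      and fin: "\<And>m. (\<integral>\<^sup>+x. ennreal ((1 + norm x) ^ m) * indicator {x. \<epsilon> < norm x} x \<partial>L) < \<infinity>" for L m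
    using fin[of m] by (intro integrableI_nonneg) (auto simp: outer_def nn_integral_density mult.commute)
  show "integrable (outer \<epsilon> M) (\<lambda>x. (1 + norm x) ^ m)" "integrable (outer \<epsilon> N) (\<lambda>x. (1 + norm x) ^ m)" for m
    using assms by (intro int sets tail_moments; simp)+
  have fin: "finite_measure (outer \<epsilon> L)" if "integrable (outer \<epsilon> L) (\<lambda>x. (1 + norm x) ^ 0)" for L
    using that by (intro finite_measureI) (simp add: integrable_iff_bounded)
  show "finite_measure (outer \<epsilon> M)" "finite_measure (outer \<epsilon> N)"
    using assms by (intro fin int sets tail_moments; simp)+
  show "sets (outer \<epsilon> M) = sets borel" "sets (outer \<epsilon> N) = sets borel" by (simp_all add: outer_def)
  show "\<epsilon> \<ge> 0" using assms by simp
  have em: "emeasure (outer \<epsilon> L) (halfspace w p) = emeasure L (halfspace w p)"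
    if [simp]: "sets L = sets borel" and "p < 0" "\<epsilon> * norm w \<le> - p" for L w p
  proof -
    have "{x. \<epsilon> < norm x} \<inter> halfspace w p = halfspace w p"
      using halfspace_subset_norm[of p \<epsilon> w] that assms by auto
    then show ?thesis by (simp add: outer_def emeasure_restricted)
  qed
  show "AE w in lborel. \<forall>p<0. \<epsilon> * norm w \<le> - p \<longrightarrow>
      emeasure (outer \<epsilon> M) (halfspace w p) = emeasure (outer \<epsilon> N) (halfspace w p)"
    using halfspaces by eventually_elim (auto simp: em)
qed

lemma halfspace_subset_outer:
  fixes u :: 'a
  assumes "a > 0" "\<epsilon> * norm u \<le> a" "\<epsilon> \<ge> 0" 
  shows "{x. a < x \<bullet> u} \<subseteq> {x. \<epsilon> < norm x}"
  using halfspace_subset_norm[of "- a" \<epsilon> "- u"] assms by (auto simp: halfspace_def)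

text \<open>The integrand depends on \<open>(x \<bullet> u, x \<bullet> v)\<close> only and vanishes
  over the disc of radius \<open>a\<close>, so the planar result applies.\<close>

lemma open_halfspace_integral_eq:
  assumes "a > 0" and g [measurable]: "g \<in> borel_measurable borel" and bound: "\<And>t. \<bar>g t\<bar> \<le> (1::real)"
  shows "(\<integral>x. indicator {x. a < x \<bullet> u} x * g (x \<bullet> v) \<partial>M) = (\<integral>x. indicator {x. a < x \<bullet> u} x * g (x \<bullet> v) \<partial>N)"
proof -
  \<comment> \<open>The summand \<open>1\<close> makes \<open>s\<close> positive and the inequality
    \<open>\<epsilon> * (norm u + norm v) < a\<close> strict.\<close>
  define s where "s = norm u + norm v + 1"
  have s: "s > 0" by (simp add: s_def add_nonneg_pos)
  define \<epsilon> where "\<epsilon> = a / s"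
  have eps: "\<epsilon> > 0" using \<open>a > 0\<close> s by (simp add: \<epsilon>_def)
  have "\<epsilon> * s = a" using s by (simp add: \<epsilon>_def)
  then have "\<epsilon> * (norm u + norm v) < a" using eps by (simp add: s_def distrib_left)
  moreover have "\<epsilon> * norm u \<le> \<epsilon> * (norm u + norm v)" using eps by simp
  ultimately have lt: "\<epsilon> * (norm u + norm v) < sqrt (a\<^sup>2)" "\<epsilon> * norm u \<le> a" using \<open>a > 0\<close> by simp_all
  interpret H: halfspace_pair "outer \<epsilon> M" "outer \<epsilon> N" \<epsilon>
    by (rule halfspace_pair_outer) fact
  define G where "G y = indicator {a<..} (fst y) * g (snd y)" for y :: "real \<times> real"
  have "(\<integral>x. G (x \<bullet> u, x \<bullet> v) \<partial>outer \<epsilon> M) = (\<integral>x. G (x \<bullet> u, x \<bullet> v) \<partial>outer \<epsilon> N)"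
  proof (rule H.plane_integral_eq[where c = "a\<^sup>2" and B = 1])
    have "fst \<in> borel_measurable (borel :: (real \<times> real) measure)" "snd \<in> borel_measurable (borel :: (real \<times> real) measure)"
      by (intro borel_measurable_continuous_onI continuous_on_fst continuous_on_snd continuous_on_id)+
    then show "G \<in> borel_measurable borel"
      unfolding G_def
      by (intro borel_measurable_times measurable_compose[where f = fst, OF _ borel_measurable_indicator]
          measurable_compose[where f = snd, OF _ g]) auto
    show "\<bar>G y\<bar> \<le> 1" for y using bound by (auto simp: G_def indicator_def)
    show "G y = 0" if "(fst y)\<^sup>2 + (snd y)\<^sup>2 \<le> a\<^sup>2" for y
    proof -
      have "(fst y)\<^sup>2 \<le> a\<^sup>2" using that zero_le_power2[of "snd y"] by linarith
      then have "fst y \<le> a" by (rule power2_le_imp_le) (use \<open>a > 0\<close> in simp)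
      then show ?thesis by (simp add: G_def)
    qed
  qed (use lt \<open>a > 0\<close> in auto)
  moreover have "(\<integral>x. G (x \<bullet> u, x \<bullet> v) \<partial>outer \<epsilon> L) = (\<integral>x. indicator {x. a < x \<bullet> u} x * g (x \<bullet> v) \<partial>L)"
    if [measurable_cong]: "sets L = sets borel" for L
  proof -
    have G: "G (x \<bullet> u, x \<bullet> v) = indicator {x. a < x \<bullet> u} x * g (x \<bullet> v)" for x
      by (simp add: G_def indicator_def)
    have "outer \<epsilon> L = density L (\<lambda>x. ennreal (indicator {x. \<epsilon> < norm x} x))"
      by (simp add: outer_def ennreal_indicator)
    then have "(\<integral>x. G (x \<bullet> u, x \<bullet> v) \<partial>outer \<epsilon> L)
        = (\<integral>x. indicator {x. \<epsilon> < norm x} x *\<^sub>R (indicator {x. a < x \<bullet> u} x * g (x \<bullet> v)) \<partial>L)"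
      unfolding G by (simp only:) (rule integral_density; measurable)
    also have "\<dots> = (\<integral>x. indicator {x. a < x \<bullet> u} x * g (x \<bullet> v) \<partial>L)"
      using halfspace_subset_outer[OF \<open>a > 0\<close> lt(2)] eps
      by (intro Bochner_Integration.integral_cong) (auto simp: indicator_def)
    finally show ?thesis .
  qed
  ultimately show ?thesis by simp
qed

text \<open>A cosine or sine of \<open>x \<bullet> v\<close> on this halfspace involves just the two
  directions \<open>u\<close> and \<open>v\<close>, so planar projections suffice in any dimension.
  Finiteness holds because the halfspace avoids a ball around the origin.\<close>

lemma density_halfspace_eq:
  assumes "a > 0"
  shows "density M (indicator {x. a < x \<bullet> u}) = density N (indicator {x. a < x \<bullet> u})"
proof (rule measure_eqI_cos_sin)
  have ms [measurable]: "{x::'a. a < x \<bullet> u} \<in> sets borel" by measurable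
  define \<epsilon> where "\<epsilon> = a / (norm u + 1)"
  have s: "norm u + 1 > 0" by (simp add: add_nonneg_pos)
  have eps: "\<epsilon> > 0" "\<epsilon> * norm u \<le> a" using \<open>a > 0\<close> s by (simp_all add: \<epsilon>_def field_simps)
  have sub: "{x. a < x \<bullet> u} \<subseteq> {x. \<epsilon> < norm x}"
    using halfspace_subset_outer[OF \<open>a > 0\<close> eps(2)] eps(1) by simp
  have fin: "finite_measure (density L (indicator {x. a < x \<bullet> u}))"
    if [measurable_cong, simp]: "sets L = sets borel"
      and "(\<integral>\<^sup>+x. ennreal ((1 + norm x) ^ 0) * indicator {x. \<epsilon> < norm x} x \<partial>L) < \<infinity>" for L
  proof (rule finite_measureI)
    have sp: "space L = UNIV" using sets_eq_imp_space_eq[OF that(1)] by simp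
    have "emeasure (density L (indicator {x. a < x \<bullet> u})) UNIV = emeasure L {x. a < x \<bullet> u}"
      using emeasure_restricted[of "{x. a < x \<bullet> u}" L UNIV] by simp
    also have "\<dots> \<le> emeasure L {x. \<epsilon> < norm x}"
      by (rule emeasure_mono[OF sub]) simp
    also have "\<dots> < \<infinity>" using that(2) by simp
    finally show "emeasure (density L (indicator {x. a < x \<bullet> u})) (space (density L (indicator {x. a < x \<bullet> u}))) \<noteq> \<infinity>"
      by (simp add: sp)
  qed
  show "finite_measure (density M (indicator {x. a < x \<bullet> u}))" "finite_measure (density N (indicator {x. a < x \<bullet> u}))"
    by (intro fin sets tail_moments eps)+
  have int: "(\<integral>x. g (x \<bullet> v) \<partial>density L (indicator {x. a < x \<bullet> u})) = (\<integral>x. indicator {x. a < x \<bullet> u} x * g (x \<bullet> v) \<partial>L)"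
    if [measurable_cong]: "sets L = sets borel" and [measurable]: "g \<in> borel_measurable borel" for L v and g :: "real \<Rightarrow> real"
  proof -
    have "density L (indicator {x. a < x \<bullet> u}) = density L (\<lambda>x. ennreal (indicator {x. a < x \<bullet> u} x))"
      by (simp add: ennreal_indicator)
    then show ?thesis by (simp add: integral_density)
  qed
  show "(\<integral>x. cos (x \<bullet> v) \<partial>density M (indicator {x. a < x \<bullet> u})) = (\<integral>x. cos (x \<bullet> v) \<partial>density N (indicator {x. a < x \<bullet> u}))" for v
    using open_halfspace_integral_eq[OF assms, of cos u v] by (simp add: int)
  show "(\<integral>x. sin (x \<bullet> v) \<partial>density M (indicator {x. a < x \<bullet> u})) = (\<integral>x. sin (x \<bullet> v) \<partial>density N (indicator {x. a < x \<bullet> u}))" for v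
    using open_halfspace_integral_eq[OF assms, of sin u v] by (simp add: int)
qed simp_all

text \<open>Every nonzero point has a nonzero coordinate, so countably many halfspaces along the
  signed basis vectors cover the complement of the origin.\<close>

lemma emeasure_eq_punctured:
  assumes A: "A \<in> sets borel" "0 \<notin> A"
  shows "emeasure M A = emeasure N A"
proof (rule emeasure_eq_countable_cover[OF sets, where \<C> = "(\<lambda>(n, u). {x. 1 / real (Suc n) < x \<bullet> u}) ` (UNIV \<times> (Basis \<union> uminus ` Basis))"])
  let ?\<C> = "(\<lambda>(n, u). {x::'a. 1 / real (Suc n) < x \<bullet> u}) ` (UNIV \<times> (Basis \<union> uminus ` Basis))"
  show "countable ?\<C>"
    using countable_finite[of "Basis \<union> uminus ` Basis :: 'a set"]
    by (intro countable_image countable_SIGMA) auto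
  show "C \<in> sets borel" if "C \<in> ?\<C>" for C
    using that by auto
  show "emeasure M B = emeasure N B" if "C \<in> ?\<C>" "B \<in> sets borel" "B \<subseteq> C" for C B
  proof -
    obtain n u where C: "C = {x. 1 / real (Suc n) < x \<bullet> u}" using \<open>C \<in> ?\<C>\<close> by auto
    have [measurable]: "C \<in> sets borel" unfolding C by measurable
    have "emeasure (density M (indicator C)) B = emeasure (density N (indicator C)) B"
      using density_halfspace_eq[of "1 / real (Suc n)" u] by (simp add: C)
    then show ?thesis
      using that by (simp add: emeasure_restricted Int_absorb1)
  qed
  show "A \<subseteq> \<Union>?\<C>"
  proof
    fix x assume "x \<in> A"
    with A(2) have "x \<noteq> 0" by auto
    then obtain b where b: "b \<in> Basis" "x \<bullet> b \<noteq> 0" using euclidean_all_zero_iff[of x] by blast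
    define u where "u = (if x \<bullet> b > 0 then b else - b)"
    have "x \<bullet> u > 0" using b(2) by (auto simp: u_def)
    then obtain n where "inverse (real (Suc n)) < x \<bullet> u" using reals_Archimedean by blast
    moreover have "u \<in> Basis \<union> uminus ` Basis" using b(1) by (auto simp: u_def)
    ultimately show "x \<in> \<Union>?\<C>" by (auto simp: inverse_eq_divide intro!: bexI[of _ u])
  qed
qed (use A in auto)

end

text \<open>The vanishing of the signed measure is stated as equality of its two parts, because a
  difference of infinite values near the origin would be meaningless. Lebesgue measure in
  \<open>fst z\<close>, followed by normalization, represents surface measure on the sphere as far
  as null sets are concerned.\<close>

theorem theorem2:
  fixes M1 M2 :: "'a::euclidean_space measure"
    and chi :: "real \<Rightarrow> 'a \<Rightarrow> real"
  assumes "signed_radon_punctured M1 M2"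
    and "cutoff_family chi"
    and "rapidly_decaying chi M1 M2"
    and "AE z in (lborel :: ('a \<times> real) measure).
           fst z \<noteq> 0 \<and> snd z < 0 \<longrightarrow>
           emeasure M1 (halfspace (fst z /\<^sub>R norm (fst z)) (snd z))
             = emeasure M2 (halfspace (fst z /\<^sub>R norm (fst z)) (snd z))"
  shows "\<forall>A\<in>sets borel. emeasure M1 A = emeasure M2 A"
proof
  have sets [simp]: "sets M1 = sets borel" "sets M2 = sets borel"
    and zero: "emeasure M1 {0} = 0" "emeasure M2 {0} = 0"
    and compact: "\<And>K. compact K \<Longrightarrow> 0 \<notin> K \<Longrightarrow> emeasure M1 K < \<infinity>"
      "\<And>K. compact K \<Longrightarrow> 0 \<notin> K \<Longrightarrow> emeasure M2 K < \<infinity>"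
    using assms(1) by (auto simp: signed_radon_punctured_def)
  have tail: "\<exists>C R. \<forall>r\<ge>R. emeasure M1 {x. r < norm x} \<le> ennreal (C * r powr (- m)) \<and>
      emeasure M2 {x. r < norm x} \<le> ennreal (C * r powr (- m))" if "m > 0" for m
  proof -
    have "\<exists>C R. \<forall>r\<ge>R. cut_tv chi M1 M2 r \<le> ennreal (C * r powr (- m))"
      using assms(3) that by (simp add: rapidly_decaying_def)
    then obtain C R where CR: "\<And>r. r \<ge> R \<Longrightarrow> cut_tv chi M1 M2 r \<le> ennreal (C * r powr (- m))"
      by blast
    have le: "emeasure M1 {x. r < norm x} \<le> cut_tv chi M1 M2 r" "emeasure M2 {x. r < norm x} \<le> cut_tv chi M1 M2 r"
      if "r > 1" for r
      using emeasure_tail_le[OF assms(2) sets(1) that] emeasure_tail_le[OF assms(2) sets(2) that]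
      by (auto simp: cut_tv_def intro: add_increasing add_increasing2)
    show ?thesis
    proof (intro exI allI impI conjI)
      \<comment> \<open>The maximum with \<open>2\<close> ensures \<open>r > 1\<close>, where the
        cutoff functions are specified.\<close>
      fix r assume "r \<ge> max R 2"
      then have r: "r \<ge> R" "r > 1" by auto
      show "emeasure M1 {x. r < norm x} \<le> ennreal (C * r powr (- m))"
        using le(1)[OF r(2)] CR[OF r(1)] by (rule order_trans)
      show "emeasure M2 {x. r < norm x} \<le> ennreal (C * r powr (- m))"
        using le(2)[OF r(2)] CR[OF r(1)] by (rule order_trans)
    qed
  qed
  interpret punctured_pair M1 M2
  proof
    show "AE w in lborel. \<forall>p<0. emeasure M1 (halfspace w p) = emeasure M2 (halfspace w p)"
      by (rule AE_halfspace_all_offsets[OF sets assms(4)])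
    show "(\<integral>\<^sup>+x. ennreal ((1 + norm x) ^ m) * indicator {x. \<epsilon> < norm x} x \<partial>M1) < \<infinity>" if "\<epsilon> > 0" for \<epsilon> m
      by (rule tail_moment_finite[OF sets(1) compact(1) _ that]) (use tail in blast)+
    show "(\<integral>\<^sup>+x. ennreal ((1 + norm x) ^ m) * indicator {x. \<epsilon> < norm x} x \<partial>M2) < \<infinity>" if "\<epsilon> > 0" for \<epsilon> m
      by (rule tail_moment_finite[OF sets(2) compact(2) _ that]) (use tail in blast)+
  qed simp_all
  fix A :: "'a set" assume A: "A \<in> sets borel"
  \<comment> \<open>The origin is a null set of both measures and can be removed from
    \<open>A\<close>.\<close>
  have "emeasure M1 (A - {0}) = emeasure M2 (A - {0})"
    using A by (intro emeasure_eq_punctured) auto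
  then show "emeasure M1 A = emeasure M2 A"
    using A zero emeasure_Diff_null_set[of "{0}" M1 A] emeasure_Diff_null_set[of "{0}" M2 A]
    by (simp add: null_sets_def)
qed

end
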